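(* Let $X$ be a closed subscheme of $\mathbb{P}^n$. Then $M(X)\leq G(X)$.
   Context: $k$ is an algebraically closed field of characteristic $0$, $R=k[x_0,\dots,x_n]$, $\mathbb{P}^n=\operatorname{Proj}R$. For a (nonempty) closed subscheme $X\subset\mathbb{P}^n$, $I_X\subset R$ is its saturated homogeneous ideal, $H_X(d)=\dim_k(R/I_X)_d$ is its Hilbert function, and $\Delta H_X(d)=H_X(d)-H_X(d-1)$. For integers $c,d>0$ the $d$-binomial expansion of $c$ is the unique expression $c=\binom{k_d}{d}+\binom{k_{d-1}}{d-1}+\cdots+\binom{k_\delta}{\delta}$ with $k_d>k_{d-1}>\cdots>k_\delta\geq\delta>0$. The $d$-th Macaulay difference set of $c$ is the tuple $M_d(c)=(k_d-d,\,k_{d-1}-(d-1),\dots,k_\delta-\delta)$, a non-increasing tuple of nonnegative integers; its length is its number of entries. Put $c_{\langle d\rangle}=\binom{k_d-1}{d}+\cdots+\binom{k_\delta-1}{\delta}$ (with $\binom ij=0$ if $i<j$). For $d\gg0$ the tuples $M_d(H_X(d))$ do not depend on $d$; this eventually constant tuple is the Gotzmann difference set of $X$, and its length is the Gotzmann number $G(X)$. $M(X)$ is the least integer $d\geq1$ such that $H(S_X/hS_X,t)=H_X(t)_{\langle t\rangle}$ for all $t\geq d$, where $S_X=R/I_X$, $h$ is a general linear form, and $H(A,t)=\dim_k A_t$; since $I_X$ is saturated, $H(S_X/hS_X,t)=\Delta H_X(t)$, so equivalently $M(X)=\min\{d\geq1 : \Delta H_X(t)=H_X(t)_{\langle t\rangle}\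 \forall t\geq d\}$. *)

theory Defs
  imports
    "HOL-Library.Poly_Mapping"
    "HOL-Computational_Algebra.Polynomial"
    "HOL-Algebra.QuotRing"
    "HOL-Algebra.Embedded_Algebras"
begin

section \<open>Polynomial rings\<close>

text \<open>
  Monomials are finitely supported exponent vectors \<^typ>\<open>nat \<Rightarrow>\<^sub>0 nat\<close>, so this type contains
  polynomials in all variables $x_0, x_1, \dots$; the polynomial ring in the variables $x_i$,
  $i \in V$, is the subring \<open>poly_ring V\<close>.
\<close>

type_synonym 'k mpoly = "(nat \<Rightarrow>\<^sub>0 nat) \<Rightarrow>\<^sub>0 'k"

definition mpolys :: "nat set \<Rightarrow> 'k::field mpoly set" where
  "mpolys V = {p. \<forall>m\<in>Poly_Mapping.keys p. Poly_Mapping.keys m \<subseteq> V}"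

definition poly_ring :: "nat set \<Rightarrow> 'k::field mpoly ring" where
  "poly_ring V = \<lparr>carrier = mpolys V, mult = (*), one = 1, zero = 0, add = (+)\<rparr>"

definition const :: "'k::field \<Rightarrow> 'k mpoly" where
  "const c = Poly_Mapping.single 0 c"

definition var :: "nat \<Rightarrow> 'k::field mpoly" where
  "var i = Poly_Mapping.single (Poly_Mapping.single i 1) 1"

definition mdeg :: "(nat \<Rightarrow>\<^sub>0 nat) \<Rightarrow> nat" where
  "mdeg m = (\<Sum>i\<in>Poly_Mapping.keys m. Poly_Mapping.lookup m i)"

text \<open>Homogeneous polynomials of degree \<open>d\<close>, together with \<open>0\<close>.\<close>

definition forms :: "nat set \<Rightarrow> nat \<Rightarrow> 'k::field mpoly set" where
  "forms V d = {p \<in> mpolys V. \<forall>m\<in>Poly_Mapping.keys p. mdeg m = d}"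

definition hom_component :: "nat \<Rightarrow> 'k::field mpoly \<Rightarrow> 'k mpoly" where
  "hom_component d p =
    (\<Sum>m \<in> {m \<in> Poly_Mapping.keys p. mdeg m = d}. Poly_Mapping.single m (Poly_Mapping.lookup p m))"

definition meval :: "(nat \<Rightarrow> 'k::field) \<Rightarrow> 'k mpoly \<Rightarrow> 'k" where
  "meval a p = (\<Sum>m\<in>Poly_Mapping.keys p.
     Poly_Mapping.lookup p m * (\<Prod>i\<in>Poly_Mapping.keys m. a i ^ Poly_Mapping.lookup m i))"

text \<open>The substitution $x_i := 1$.\<close>

definition dehom :: "nat \<Rightarrow> 'k::field mpoly \<Rightarrow> 'k mpoly" where
  "dehom i p = (\<Sum>m\<in>Poly_Mapping.keys p.
     Poly_Mapping.single (Poly_Mapping.update i 0 m) (Poly_Mapping.lookup p m))"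


section \<open>Closed subschemes of projective space\<close>

text \<open>
  A closed subscheme of $\mathbb{P}^n$ is a quasi-coherent sheaf of ideals, i.e. a family of ideals
  $\mathfrak{a}_i$ of the coordinate rings $k[x_0/x_i, \dots, x_n/x_i]$ of the standard charts
  $D_+(x_i)$, for $i \le n$, such that $\mathfrak{a}_i$ and $\mathfrak{a}_j$ generate the same ideal
  on $D_+(x_i x_j)$.  The function \<open>X\<close> below is this family (only its values at \<open>i \<le> n\<close> matter).
  The chart ring is \<open>poly_ring ({..n} - {i})\<close>, with $x_j$ in the role of $x_j/x_i$, so that
  \<open>dehom i f\<close> represents $f/x_i^d$ for a form \<open>f\<close> of degree \<open>d\<close>.
  The sections of the structure sheaf over $D_+(x_i x_j)$ are, up to units, of the form
  $(f/x_i^d) / (x_j/x_i)^e$, and such a section lies in the localisation of $\mathfrak{a}_i$ at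
  $x_j/x_i$ iff $(x_j/x_i)^m f/x_i^d \in \mathfrak{a}_i$ for some \<open>m\<close>.
\<close>

definition closed_subscheme :: "nat \<Rightarrow> (nat \<Rightarrow> 'k::field mpoly set) \<Rightarrow> bool" where
  "closed_subscheme n X \<longleftrightarrow>
     (\<forall>i\<le>n. ideal (X i) (poly_ring ({..n} - {i}))) \<and>
     (\<forall>i\<le>n. \<forall>j\<le>n. \<forall>d. \<forall>f\<in>forms {..n} d.
        (\<exists>m. dehom i (var j ^ m * f) \<in> X i) \<longleftrightarrow> (\<exists>m. dehom j (var i ^ m * f) \<in> X j))"

definition nonempty_subscheme :: "nat \<Rightarrow> (nat \<Rightarrow> 'k::field mpoly set) \<Rightarrow> bool" where
  "nonempty_subscheme n X \<longleftrightarrow> (\<exists>i\<le>n. X i \<noteq> carrier (poly_ring ({..n} - {i})))"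

text \<open>
  The saturated homogeneous ideal $I_X = \bigoplus_d \Gamma(\mathbb{P}^n, \mathcal{I}_X(d))$: it is
  spanned by the forms that vanish on \<open>X\<close> in every chart.
\<close>

definition saturated_ideal :: "nat \<Rightarrow> (nat \<Rightarrow> 'k::field mpoly set) \<Rightarrow> 'k mpoly set" where
  "saturated_ideal n X = {p \<in> mpolys {..n}. \<forall>d. \<forall>i\<le>n. dehom i (hom_component d p) \<in> X i}"

definition coord_ring :: "nat \<Rightarrow> (nat \<Rightarrow> 'k::field mpoly set) \<Rightarrow> 'k mpoly set ring" where
  "coord_ring n X = poly_ring {..n} Quot saturated_ideal n X"

definition coord_class :: "nat \<Rightarrow> (nat \<Rightarrow> 'k::field mpoly set) \<Rightarrow> 'k mpoly \<Rightarrow> 'k mpoly set" where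
  "coord_class n X f = saturated_ideal n X +>\<^bsub>poly_ring {..n}\<^esub> f"

definition hilbert_function :: "nat \<Rightarrow> (nat \<Rightarrow> 'k::field mpoly set) \<Rightarrow> nat \<Rightarrow> nat" where
  "hilbert_function n X d =
     ring.dim (coord_ring n X) (coord_class n X ` range const) (coord_class n X ` forms {..n} d)"


section \<open>Hyperplane sections\<close>

definition linear_form :: "nat \<Rightarrow> (nat \<Rightarrow> 'k::field) \<Rightarrow> 'k mpoly" where
  "linear_form n a = (\<Sum>i\<le>n. const (a i) * var i)"

text \<open>
  A property holds for a general linear form if it holds on a nonempty Zariski open subset of the
  space $k^{n+1}$ of coefficient vectors; it is enough to consider basic open sets $F \ne 0$.
\<close>

definition for_general_linear_form :: "nat \<Rightarrow> ('k::field mpoly \<Rightarrow> bool) \<Rightarrow> bool" where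
  "for_general_linear_form n P \<longleftrightarrow>
     (\<exists>F\<in>mpolys {..n}. (\<exists>a. meval a F \<noteq> 0) \<and> (\<forall>a. meval a F \<noteq> 0 \<longrightarrow> P (linear_form n a)))"

definition section_ideal ::
    "nat \<Rightarrow> (nat \<Rightarrow> 'k::field mpoly set) \<Rightarrow> 'k mpoly \<Rightarrow> 'k mpoly set set" where
  "section_ideal n X h = PIdl\<^bsub>coord_ring n X\<^esub> (coord_class n X h)"

definition section_ring ::
    "nat \<Rightarrow> (nat \<Rightarrow> 'k::field mpoly set) \<Rightarrow> 'k mpoly \<Rightarrow> 'k mpoly set set ring" where
  "section_ring n X h = coord_ring n X Quot section_ideal n X h"

definition section_class ::
    "nat \<Rightarrow> (nat \<Rightarrow> 'k::field mpoly set) \<Rightarrow> 'k mpoly \<Rightarrow> 'k mpoly \<Rightarrow> 'k mpoly set set" where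
  "section_class n X h f = section_ideal n X h +>\<^bsub>coord_ring n X\<^esub> coord_class n X f"

text \<open>The Hilbert function of $S_X/hS_X$.\<close>

definition section_hilbert_function ::
    "nat \<Rightarrow> (nat \<Rightarrow> 'k::field mpoly set) \<Rightarrow> 'k mpoly \<Rightarrow> nat \<Rightarrow> nat" where
  "section_hilbert_function n X h t =
     ring.dim (section_ring n X h)
       (section_class n X h ` range const) (section_class n X h ` forms {..n} t)"


section \<open>Binomial expansions and Macaulay difference sets\<close>

text \<open>The list \<open>ks\<close> is $[k_d, k_{d-1}, \dots, k_\delta]$, so $\delta = d - (\mathit{length}\ ks - 1)$.\<close>

definition is_binomial_expansion :: "nat \<Rightarrow> nat \<Rightarrow> nat list \<Rightarrow> bool" where
  "is_binomial_expansion d c ks \<longleftrightarrow>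
     ks \<noteq> [] \<and> length ks \<le> d \<and> sorted_wrt (>) ks \<and> last ks \<ge> d - (length ks - 1) \<and>
     c = (\<Sum>i<length ks. (ks ! i) choose (d - i))"

definition binomial_expansion :: "nat \<Rightarrow> nat \<Rightarrow> nat list" where
  "binomial_expansion d c = (THE ks. is_binomial_expansion d c ks)"

definition macaulay_difference_set :: "nat \<Rightarrow> nat \<Rightarrow> nat list" where
  "macaulay_difference_set d c =
     (let ks = binomial_expansion d c in map (\<lambda>i. ks ! i - (d - i)) [0..<length ks])"

text \<open>$c_{\langle d\rangle}$\<close>

definition macaulay_lower :: "nat \<Rightarrow> nat \<Rightarrow> nat" where
  "macaulay_lower d c =
     (let ks = binomial_expansion d c in \<Sum>i<length ks. (ks ! i - 1) choose (d - i))"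


section \<open>The invariants $G(X)$ and $M(X)$\<close>

definition gotzmann_difference_set :: "nat \<Rightarrow> (nat \<Rightarrow> 'k::field mpoly set) \<Rightarrow> nat list" where
  "gotzmann_difference_set n X =
     (THE T. \<forall>\<^sub>F d in sequentially. macaulay_difference_set d (hilbert_function n X d) = T)"

definition gotzmann_number :: "nat \<Rightarrow> (nat \<Rightarrow> 'k::field mpoly set) \<Rightarrow> nat" where
  "gotzmann_number n X = length (gotzmann_difference_set n X)"

definition M_number :: "nat \<Rightarrow> (nat \<Rightarrow> 'k::field mpoly set) \<Rightarrow> nat" where
  "M_number n X =
     (LEAST d. d \<ge> 1 \<and> for_general_linear_form n (\<lambda>h.
        \<forall>t\<ge>d. section_hilbert_function n X h t = macaulay_lower t (hilbert_function n X t)))"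

end

theory Submission
  imports Defs "HOL-Library.Multiset_Order"
begin

text \<open>
  Write \<open>r\<close> for the length of the Gotzmann difference set \<open>T\<close>, \<open>H\<close> for the Hilbert function of \<open>X\<close>
  and \<open>P(t)\<close> for the number with \<open>t\<close>-th Macaulay difference set \<open>T\<close>. Everything rests on Green's
  theorem: for a general linear form \<open>h\<close>, the quotient by \<open>h\<close> has Hilbert function at most
  \<open>H(t)\<^sub>\<langle>\<^sub>t\<^sub>\<rangle>\<close>. Together with the sequence
  $0 \to R/(I:h)(-1) \to R/I \to R/(I,h) \to 0$ it yields Macaulay's bound, for arbitrary homogeneous
  ideals: the Macaulay difference sets decrease lexicographically in \<open>t\<close>, hence stabilize, and
  \<open>H(t) \<ge> P(t)\<close> for \<open>t \<ge> r - 1\<close>.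

  For the converse inequality no cohomology is needed. If \<open>h\<close> is regular on \<open>R/I\<close> in the finitely
  many degrees that matter, then \<open>(I,h)\<close> has Hilbert function \<open>P(t) - P(t-1)\<close> in one large degree, and
  the difference set of this number is no longer than \<open>T\<close>. The lower bound just mentioned, applied to
  \<open>(I,h)\<close>, says \<open>H(t) - H(t-1) \<ge> P(t) - P(t-1)\<close> for \<open>t \<ge> r\<close>; descending from large \<open>t\<close>
  gives \<open>H(t) \<le> P(t)\<close> for \<open>t \<ge> r - 1\<close>. So \<open>H = P\<close> from degree \<open>r - 1\<close> on.

  Finally, if \<open>h\<close> is regular in degree \<open>r - 1\<close> only, which is an open condition, then \<open>(I,h)\<close> has
  Hilbert function \<open>P(r) - P(r-1)\<close> in degree \<open>r\<close>. In all degrees \<open>t \<ge> r\<close> it is at most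
  \<open>P(t) - P(t-1)\<close> by Macaulay's bound, and at least this by exactness.
\<close>

section \<open>Macaulay difference sets\<close>

text \<open>If \<open>a\<close> is the \<open>d\<close>-th Macaulay difference set of \<open>c\<close>, then \<open>tval d a\<close>, \<open>tlow d a\<close> and
  \<open>tdiff d a\<close> are $c$, $c_{\langle d\rangle}$ and $c - c_{\langle d\rangle}$; here \<open>c = 0\<close> has the
  empty difference set.\<close>

definition tuple :: "nat \<Rightarrow> nat list \<Rightarrow> bool" where
  "tuple d a \<longleftrightarrow> sorted_wrt (\<ge>) a \<and> length a \<le> d"

fun tval :: "nat \<Rightarrow> nat list \<Rightarrow> nat" where
  "tval d [] = 0"
| "tval d (x # a) = (d + x choose d) + tval (d - 1) a"

fun tlow :: "nat \<Rightarrow> nat list \<Rightarrow> nat" where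
  "tlow d [] = 0"
| "tlow d (x # a) = (d + x - 1 choose d) + tlow (d - 1) a"

fun tdiff :: "nat \<Rightarrow> nat list \<Rightarrow> nat" where
  "tdiff d [] = 0"
| "tdiff d (x # a) = (d + x - 1 choose (d - 1)) + tdiff (d - 1) a"

section \<open>Bounds, existence and uniqueness of Macaulay expansions\<close>

lemma tuple_Nil [simp]: "tuple d []"
  by (simp add: tuple_def)

lemma tuple_0 [simp]: "tuple 0 a \<longleftrightarrow> a = []"
  by (auto simp: tuple_def)

lemma tuple_Cons: "tuple d (x # a) \<longleftrightarrow> d > 0 \<and> tuple (d - 1) a \<and> (\<forall>y\<in>set a. y \<le> x)"
  by (auto simp: tuple_def)

lemma pascal: "d > 0 \<Longrightarrow> m > 0 \<Longrightarrow> m choose d = (m - 1 choose (d - 1)) + (m - 1 choose d)"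
  by (cases d; cases m) auto

lemma tval_Cons_pos: "tval d (x # a) > 0"
  by simp

lemma tval_eq: "length a \<le> d \<Longrightarrow> tval d a = tlow d a + tdiff d a"
proof (induction a arbitrary: d)
  case (Cons x a)
  then show ?case
    using pascal[of d "d + x"] by (cases d) auto
qed simp

text \<open>With first entry \<open>y\<close>, the tail stays below C(d + y, d - 1) by induction,
  and Pascal's rule adds this to C(d + y, d). So the first entry dominates everything after
  it.\<close>

lemma tval_bound: "tuple d a \<Longrightarrow> \<forall>y\<in>set a. y \<le> x \<Longrightarrow> tval d a < (d + x + 1 choose d)"
proof (induction a arbitrary: d x)
  case (Cons y a)
  then have d: "d > 0" and a: "tuple (d - 1) a" "\<forall>z\<in>set a. z \<le> y" and y: "y \<le> x"
    by (auto simp: tuple_Cons)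
  have "tval d (y # a) < (d + y choose d) + (d - 1 + y + 1 choose (d - 1))"
    using Cons.IH[OF a] by simp
  also have "\<dots> = (d + y + 1 choose d)"
    using d pascal[of d "d + y + 1"] by simp
  also have "\<dots> \<le> (d + x + 1 choose d)"
    using y by (intro binomial_right_mono) auto
  finally show ?case .
qed simp

lemma tlow_bound: "tuple d a \<Longrightarrow> \<forall>y\<in>set a. y \<le> x \<Longrightarrow> tlow d a < (d + x choose d)"
proof (induction a arbitrary: d x)
  case (Cons y a)
  then have d: "d > 0" and a: "tuple (d - 1) a" "\<forall>z\<in>set a. z \<le> y" and y: "y \<le> x"
    by (auto simp: tuple_Cons)
  have "tlow d (y # a) < (d + y - 1 choose d) + (d - 1 + y choose (d - 1))"
    using Cons.IH[OF a] by simp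
  also have "\<dots> = (d + y choose d)"
    using d pascal[of d "d + y"] by simp
  also have "\<dots> \<le> (d + x choose d)"
    using y by (intro binomial_right_mono) auto
  finally show ?case .
qed simp

text \<open>Unlike the two preceding bounds this one is not strict: in degree 1 both sides equal 1
  for every nonempty tuple.\<close>

lemma tdiff_bound: "tuple d a \<Longrightarrow> d > 0 \<Longrightarrow> \<forall>y\<in>set a. y \<le> x \<Longrightarrow> tdiff d a \<le> (d + x choose (d - 1))"
proof (induction a arbitrary: d x)
  case (Cons y a)
  then have d: "d > 0" and a: "tuple (d - 1) a" "\<forall>z\<in>set a. z \<le> y" and y: "y \<le> x"
    by (auto simp: tuple_Cons)
  have "tdiff d (y # a) \<le> (d + y choose (d - 1))"
  proof (cases "d = 1")
    case False
    then have "tdiff d (y # a) \<le> (d + y - 1 choose (d - 1)) + (d - 1 + y choose (d - 2))"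
      using Cons.IH[OF a(1) _ a(2)] d by (simp add: numeral_2_eq_2)
    also have "\<dots> = (d + y choose (d - 1))"
      using d False pascal[of "d - 1" "d + y"] by (simp add: numeral_2_eq_2)
    finally show ?thesis .
  qed (use a in auto)
  also have "\<dots> \<le> (d + x choose (d - 1))"
    using y by (intro binomial_right_mono) auto
  finally show ?case .
qed simp

text \<open>The greedy algorithm: \<open>x\<close> is lowered until its binomial fits into
  \<open>c\<close>, and the remainder is expanded one degree lower under the same bound on the
  entries.\<close>

lemma tuple_exists_bounded:
  "c < (d + x + 1 choose d) \<Longrightarrow> \<exists>a. tuple d a \<and> (\<forall>y\<in>set a. y \<le> x) \<and> tval d a = c"
proof (induction d arbitrary: c x)
  case 0
  then show ?case by (intro exI[of _ "[]"]) simp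
next
  case (Suc d)
  note IH = Suc.IH
  from Suc.prems show ?case
  proof (induction x)
    case 0
    show ?case
    proof (cases "c = 0")
      case False
      define c' where "c' = c - 1"
      have "c' < (d + 0 + 1 choose d)"
        using 0 False by (simp add: c'_def)
      from IH[OF this] obtain a where "tuple d a" "\<forall>y\<in>set a. y \<le> 0" "tval d a = c'"
        by blast
      then show ?thesis
        using False by (intro exI[of _ "0 # a"]) (auto simp: tuple_Cons c'_def)
    qed (auto intro: exI[of _ "[]"])
  next
    case (Suc x)
    show ?case
    proof (cases "c < (Suc d + x + 1 choose Suc d)")
      case True
      from Suc.IH[OF this] obtain a where "tuple (Suc d) a" "\<forall>y\<in>set a. y \<le> x" "tval (Suc d) a = c"
        by blast
      then show ?thesis by (intro exI[of _ a]) auto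
    next
      case False
      define c' where "c' = c - (Suc d + x + 1 choose Suc d)"
      have "c' < (d + Suc x + 1 choose d)"
        using Suc.prems False pascal[of "Suc d" "Suc d + Suc x + 1"] by (simp add: c'_def)
      from IH[OF this] obtain a where "tuple d a" "\<forall>y\<in>set a. y \<le> Suc x" "tval d a = c'"
        by blast
      then show ?thesis
        using False by (intro exI[of _ "Suc x # a"]) (auto simp: tuple_Cons c'_def)
    qed
  qed
qed

lemma tuple_exists:
  assumes "d > 0"
  shows "\<exists>a. tuple d a \<and> tval d a = c"
proof -
  have "c < (d + c + 1 choose d)"
  proof (induction c)
    case (Suc c)
    have "(d + c + 1 choose (d - 1)) > 0" by simp
    moreover have "(d + Suc c + 1 choose d) = (d + c + 1 choose (d - 1)) + (d + c + 1 choose d)"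
      using pascal[of d "d + Suc c + 1"] assms by simp
    ultimately show ?case using Suc by linarith
  qed simp
  then show ?thesis using tuple_exists_bounded by blast
qed

text \<open>By \<open>tval_bound\<close> no tail makes up for a smaller first entry. Hence values
  order tuples lexicographically, the source of both uniqueness and monotonicity.\<close>

lemma tval_less:
  assumes "tuple d (x # a)" "x < y"
  shows "tval d (x # a) < tval d (y # b)"
proof -
  have "tval d (x # a) < (d + x + 1 choose d)"
    using assms by (intro tval_bound) (auto simp: tuple_Cons)
  also have "\<dots> \<le> (d + y choose d)"
    using assms by (intro binomial_right_mono) auto
  finally show ?thesis by simp
qed

lemma tval_inj: "tuple d a \<Longrightarrow> tuple d b \<Longrightarrow> tval d a = tval d b \<Longrightarrow> a = b"
proof (induction a arbitrary: d b)
  case Nil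
  then show ?case by (cases b) auto
next
  case (Cons x a)
  then have "tval d b > 0" using tval_Cons_pos[of d x a] by simp
  then obtain y b' where b: "b = y # b'" by (cases b) auto
  have "x = y"
    using tval_less[of d x a y b'] tval_less[of d y b' x a] Cons.prems b by (cases x y rule: linorder_cases) auto
  then show ?case
    using Cons.prems b Cons.IH[of "d - 1" b'] by (auto simp: tuple_Cons)
qed

definition mac :: "nat \<Rightarrow> nat \<Rightarrow> nat list" where
  "mac d c = (THE a. tuple d a \<and> tval d a = c)"

lemma mac_eqI: "tuple d a \<Longrightarrow> tval d a = c \<Longrightarrow> mac d c = a"
  unfolding mac_def by (rule the_equality) (auto intro: tval_inj)

lemma
  assumes "d > 0"
  shows tuple_mac [simp]: "tuple d (mac d c)" and tval_mac [simp]: "tval d (mac d c) = c"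
  using tuple_exists[OF assms, of c] mac_eqI[of d _ c] by auto

section \<open>Monotonicity and the inequality behind Green's theorem\<close>

lemma tlow_tdiff_mono:
  "tuple d a \<Longrightarrow> tuple d b \<Longrightarrow> tval d a \<le> tval d b \<Longrightarrow> tlow d a \<le> tlow d b \<and> tdiff d a \<le> tdiff d b"
proof (induction a arbitrary: d b)
  case (Cons x a)
  from Cons.prems have d: "d > 0" by (simp add: tuple_Cons)
  have "tval d b > 0"
    using tval_Cons_pos[of d x a] Cons.prems by linarith
  then obtain y b' where b: "b = y # b'" by (cases b) auto
  have xy: "x \<le> y"
    using tval_less[of d y b' x a] Cons.prems b by (meson leI not_le)
  show ?case
  proof (cases "x = y")
    case True
    then show ?thesis
      using Cons.prems b Cons.IH[of "d - 1" b'] by (auto simp: tuple_Cons)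
  next
    case False
    \<comment> \<open>The first entry of \<open>b\<close> is larger, and its contribution alone
      covers the bounds for the whole tuple \<open>x # a\<close>.\<close>
    have "tlow d (x # a) < (d + x choose d)"
      using Cons.prems by (intro tlow_bound) (auto simp: tuple_Cons)
    also have "\<dots> \<le> (d + y - 1 choose d)"
      using False xy by (intro binomial_right_mono) auto
    finally have 1: "tlow d (x # a) \<le> tlow d b" by (simp add: b)
    have "tdiff d (x # a) \<le> (d + x choose (d - 1))"
      using Cons.prems d by (intro tdiff_bound) (auto simp: tuple_Cons)
    also have "\<dots> \<le> (d + y - 1 choose (d - 1))"
      using False xy by (intro binomial_right_mono) auto
    finally show ?thesis using 1 by (simp add: b)
  qed
qed simp

text \<open>Each binomial in \<open>tdiff d a\<close> belongs to the same entry in degree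
  \<open>d - 1\<close>. Only a tuple of full length \<open>d\<close> has an entry left over; it sits
  in degree 0 and contributes the extra 1.\<close>

lemma tdiff_le_tval_take: "length a \<le> d \<Longrightarrow> tdiff d a \<le> tval (d - 1) (take (d - 1) a) + 1"
proof (induction a arbitrary: d)
  case (Cons x a)
  then obtain e where d: "d = Suc e" by (cases d) auto
  show ?case
  proof (cases e)
    case 0
    then show ?thesis using Cons.prems d by auto
  next
    case (Suc f)
    then show ?thesis using Cons.IH[of e] Cons.prems d by simp
  qed
qed simp

text \<open>Lowering decreases the entries of \<open>a\<close> by one, so the first entry
  \<open>y\<close> of \<open>b\<close> is at least \<open>x - 1\<close>. On equality the first
  summands of both sides coincide and induction treats the tails; if \<open>y >= x\<close>, the
  first summand of \<open>tdiff d b\<close> exceeds the whole right-hand side.\<close>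

lemma tlow_take_less_tdiff:
  "tuple d a \<Longrightarrow> tuple d b \<Longrightarrow> tval d b > tlow d a \<Longrightarrow> tdiff d b > tlow (d - 1) (take (d - 1) a)"
proof (induction a arbitrary: d b)
  case Nil
  then obtain y b' where "b = y # b'" by (cases b) auto
  then show ?case using Nil by (auto simp: tuple_Cons)
next
  case (Cons x a)
  then obtain y b' where b: "b = y # b'" by (cases b) auto
  from Cons.prems have d: "d > 0" by (simp add: tuple_Cons)
  have "(d + y - 1 choose (d - 1)) > 0"
    using d by (intro zero_less_binomial) simp
  then have pos: "tdiff d b > 0" using b by simp
  show ?case
  proof (cases "d = 1 \<or> x = 0")
    case True
    have "tlow (d - 1) (take (d - 1) (x # a)) = 0"
    proof (cases "d = 1")
      case False
      with True have "x = 0" by simp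
      have "tuple (d - 1) (take (d - 1) (x # a))"
        using Cons.prems by (auto simp: tuple_def sorted_wrt_take)
      moreover have "\<forall>z\<in>set (take (d - 1) (x # a)). z \<le> 0"
      proof -
        have "\<forall>z\<in>set (x # a). z \<le> 0"
          using Cons.prems(1) \<open>x = 0\<close> by (simp add: tuple_Cons)
        then show ?thesis by (meson in_set_takeD)
      qed
      ultimately show ?thesis using tlow_bound[of "d - 1" _ 0] by fastforce
    qed simp
    then show ?thesis using pos by simp
  next
    case False
    define e where "e = d - 2"
    have e: "d = Suc (Suc e)" using False d unfolding e_def by arith
    from False have x: "x > 0" by simp
    have "x - 1 \<le> y"
    proof (rule ccontr)
      assume "\<not> x - 1 \<le> y"
      \<comment> \<open>The value of the one-entry tuple \<open>[x - 1]\<close> is the first summand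
        of \<open>tlow d (x # a)\<close>.\<close>
      then have "tval d b < tval d ((x - 1) # [])"
        unfolding b using Cons.prems b by (intro tval_less) simp_all
      also have "\<dots> \<le> tlow d (x # a)" using x by simp
      finally show False using Cons.prems by simp
    qed
    then consider "y = x - 1" | "y \<ge> x" by linarith
    then show ?thesis
    proof cases
      case 1
      have "tdiff (d - 1) b' > tlow (d - 1 - 1) (take (d - 1 - 1) a)"
        using Cons.prems b 1 x by (intro Cons.IH) (auto simp: tuple_Cons)
      then show ?thesis using 1 b x e by simp
    next
      case 2
      have "tuple e (take e a)" "\<forall>z\<in>set (take e a). z \<le> x"
        using Cons.prems e by (auto simp: tuple_Cons tuple_def sorted_wrt_take dest: in_set_takeD)
      then have "tlow e (take e a) < (e + x choose e)" by (rule tlow_bound)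
      then have "tlow (d - 1) (take (d - 1) (x # a)) < (d + x - 1 choose (d - 1))"
        using e x pascal[of "Suc e" "Suc e + x"] by simp
      also have "\<dots> \<le> (d + y - 1 choose (d - 1))"
        using 2 by (intro binomial_right_mono) auto
      finally show ?thesis using b by simp
    qed
  qed
qed

text \<open>In Green's theorem \<open>a\<close>, \<open>b\<close>, \<open>f\<close> are the
  difference sets of R/I and R/(I,h) in degree \<open>d\<close> and of R/(I:h) in degree
  \<open>d - 1\<close>; \<open>sum\<close> is the exact sequence and \<open>le\<close> comes from
  restricting it to a second linear form. If the bound failed, \<open>sum\<close> would make the
  value of \<open>f\<close> at most that of \<open>a\<close> cut to \<open>d - 1\<close> entries, so
  \<open>tlow (d - 1) f\<close> would be less than \<open>tdiff d b\<close>, against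
  \<open>le\<close>.\<close>

lemma green_numeric:
  assumes a: "tuple d a" and b: "tuple d b" and f: "tuple (d - 1) f"
    and sum: "tval d a = tval d b + tval (d - 1) f"
    and le: "tval d b \<le> tlow (d - 1) f + tlow d b"
  shows "tval d b \<le> tlow d a"
proof (rule ccontr)
  assume *: "\<not> ?thesis"
  have len: "length a \<le> d" "length b \<le> d" using a b by (auto simp: tuple_def)
  have t: "tuple (d - 1) (take (d - 1) a)"
    using a by (auto simp: tuple_def sorted_wrt_take)
  have "tval (d - 1) f \<le> tval (d - 1) (take (d - 1) a)"
    using * sum tval_eq[OF len(1)] tdiff_le_tval_take[OF len(1)] by simp
  then have "tlow (d - 1) f \<le> tlow (d - 1) (take (d - 1) a)"
    using tlow_tdiff_mono[OF f t] by simp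
  also have "\<dots> < tdiff d b"
    using * by (intro tlow_take_less_tdiff[OF a b]) simp
  finally show False
    using le tval_eq[OF len(2)] by simp
qed

section \<open>Changing the degree and lowering the entries of a difference set\<close>

lemma tdiff_eq_tval: "length a \<le> d \<Longrightarrow> tdiff d a = tval (d - 1) a"
proof (induction a arbitrary: d)
  \<comment> \<open>A list of length \<open>d\<close> is evaluated in degree \<open>d - 1\<close>
    although it is not a tuple there: its last entry lands in degree 0 and counts as 1.\<close>
  case (Cons x a)
  then show ?case by (cases d) auto
qed simp

lemma tval_snoc_0: "length a \<le> d \<Longrightarrow> tval d (a @ [0]) = tval d a + 1"
  by (induction a arbitrary: d) auto

lemma tuple_snoc_0: "tuple d a \<Longrightarrow> length a < d \<Longrightarrow> tuple d (a @ [0])"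
  by (auto simp: tuple_def sorted_wrt_append)

text \<open>Otherwise \<open>b\<close> would have at least the value of \<open>a @ [0]\<close>, the
  successor of \<open>a\<close> in degree \<open>Suc d\<close>, and by monotonicity
  \<open>tdiff (Suc d) b\<close> would exceed \<open>tval d a\<close>.\<close>

lemma tval_growth:
  assumes a: "tuple d a" and b: "tuple (Suc d) b" and le: "tdiff (Suc d) b \<le> tval d a"
  shows "tval (Suc d) b \<le> tval (Suc d) a"
proof (rule ccontr)
  assume "\<not> ?thesis"
  moreover have len: "length a \<le> d" using a by (simp add: tuple_def)
  ultimately have "tval (Suc d) (a @ [0]) \<le> tval (Suc d) b"
    by (simp add: tval_snoc_0)
  moreover have "tuple (Suc d) (a @ [0])"
    using a len by (intro tuple_snoc_0) (auto simp: tuple_def)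
  ultimately have "tdiff (Suc d) (a @ [0]) \<le> tdiff (Suc d) b"
    using tlow_tdiff_mono b by blast
  then show False
    using le len by (simp add: tdiff_eq_tval tval_snoc_0)
qed

text \<open>The difference set of the lowered number: in a non-increasing list everything from the
  first zero on is zero, and a zero in degree j > 0 contributes C(j - 1, j) = 0.\<close>

fun tdec :: "nat list \<Rightarrow> nat list" where
  "tdec [] = []"
| "tdec (x # a) = (if x = 0 then [] else (x - 1) # tdec a)"

lemma set_tdec: "y \<in> set (tdec a) \<Longrightarrow> Suc y \<in> set a"
  by (induction a) (auto split: if_splits)

lemma tuple_tdec: "tuple d a \<Longrightarrow> tuple d (tdec a)"
proof (induction a arbitrary: d)
  case (Cons x a)
  have "y \<le> x - 1" if "y \<in> set (tdec a)" for y
    using set_tdec[OF that] Cons.prems by (auto simp: tuple_Cons)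
  then show ?case using Cons by (simp add: tuple_Cons)
qed simp

lemma tlow_eq_tval_tdec: "tuple d a \<Longrightarrow> tlow d a = tval d (tdec a)"
proof (induction a arbitrary: d)
  case (Cons x a)
  show ?case
  proof (cases "x = 0")
    case True
    then have "tlow d (x # a) < (d + 0 choose d)"
      using Cons.prems by (intro tlow_bound) (auto simp: tuple_Cons)
    then show ?thesis using True by simp
  qed (use Cons in \<open>auto simp: tuple_Cons\<close>)
qed simp

section \<open>Lexicographic comparison of difference sets in consecutive degrees\<close>

lemma mset_less_if_head_less:
  assumes "\<forall>z\<in>set (a :: nat list). z < y"
  shows "mset a < mset (y # b)"
proof -
  have "mset a < {#y#}"
    using assms by (intro ex_gt_imp_less_multiset) (auto intro!: exI[of _ y])
  also have "\<dots> \<le> mset (y # b)"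
    by (intro subset_eq_imp_le_multiset) simp
  finally show ?thesis .
qed

text \<open>By \<open>tdiff_eq_tval\<close> this compares two values in degree \<open>d\<close>. As
  \<open>a\<close> may have \<open>d + 1\<close> entries, it need not be a tuple there; the first
  entries are compared directly, and a larger one in \<open>b\<close> decides the multiset
  order.\<close>

lemma mset_tuple_le:
  "tuple (Suc d) a \<Longrightarrow> tuple d b \<Longrightarrow> tdiff (Suc d) a \<le> tval d b \<Longrightarrow> mset a \<le> mset b"
proof (induction a arbitrary: d b)
  case (Cons x a)
  have "(d + x choose d) > 0" by (rule zero_less_binomial) simp
  moreover have "(d + x choose d) \<le> tval d b" using Cons.prems(3) by simp
  ultimately have "tval d b > 0" by (rule less_le_trans)
  then obtain y b' where b: "b = y # b'" by (cases b) auto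
  with Cons.prems obtain e where d: "d = Suc e" by (cases d) auto
  have "tval d b < (d + y + 1 choose d)"
    using Cons.prems b by (intro tval_bound) (auto simp: tuple_Cons)
  with Cons.prems have "(d + x choose d) < (d + y + 1 choose d)" by simp
  then have xy: "x \<le> y"
    by (metis Suc_eq_plus1 add_Suc_right add_le_mono1 add.commute binomial_right_mono leD leI less_eq_Suc_le)
  show ?case
  proof (cases "x = y")
    case True
    have "mset a \<le> mset b'"
      using Cons.prems b True d by (intro Cons.IH[of e]) (auto simp: tuple_Cons)
    then show ?thesis using True b by simp
  next
    case False
    then have "\<forall>z\<in>set (x # a). z < y"
      using Cons.prems xy by (auto simp: tuple_Cons)
    then show ?thesis using mset_less_if_head_less[of "x # a" y b'] b by simp
  qed
qed simp

lemma tuple_mset_eq: "tuple d a \<Longrightarrow> tuple e b \<Longrightarrow> mset a = mset b \<Longrightarrow> a = b"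
  by (metis mset_rev properties_for_sort rev_rev_ident sorted_wrt_rev tuple_def)

text \<open>The well-ordering of multisets is the lexicographic order of non-increasing tuples, so
  a decreasing sequence of tuples stabilizes.\<close>

lemma tuples_eventually_constant:
  assumes a: "\<And>d. d > 0 \<Longrightarrow> tuple d (a d)"
    and le: "\<And>d. d > 0 \<Longrightarrow> tdiff (Suc d) (a (Suc d)) \<le> tval d (a d)"
  obtains N where "\<And>d. d \<ge> N \<Longrightarrow> a d = a N" "N > 0"
proof -
  have dec: "mset (a (Suc d)) \<le> mset (a d)" if "d > 0" for d
    using mset_tuple_le a le that by blast
  have mono: "mset (a e) \<le> mset (a d)" if "d > 0" "d \<le> e" for d e
    using that(2,1)
  proof (induction rule: dec_induct)
    case (step e)
    then have "mset (a (Suc e)) \<le> mset (a e)" by (intro dec) simp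
    with step show ?case by (meson order_trans)
  qed simp
  define M where "M = (LEAST M. \<exists>d>0. M = mset (a d))"
  have "\<exists>d>0. M = mset (a d)"
    unfolding M_def by (rule LeastI_ex) auto
  then obtain N where N: "N > 0" "M = mset (a N)" by blast
  have "a d = a N" if "d \<ge> N" for d
  proof -
    have "M \<le> mset (a d)"
      unfolding M_def using that N by (intro Least_le exI[of _ d]) auto
    then have "mset (a d) = mset (a N)"
      using mono[of N d] N that by simp
    then show ?thesis
      using tuple_mset_eq a N that by (metis less_le_trans)
  qed
  then show thesis using that N by blast
qed

section \<open>Finite-dimensional subspaces\<close>

text \<open>A copy of \<open>vector_space\<close>: additions to that locale itself would be shadowed by its global
  interpretation for real vector spaces.\<close>

locale linear_space = vector_space scale
  for scale :: "'a::field \<Rightarrow> 'b::ab_group_add \<Rightarrow> 'b"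
begin

text \<open>\<open>dim\<close> is the cardinality of a basis, hence 0 for an infinite one, so
  dimensions are compared only in the presence of a finite spanning set.\<close>

definition fin_dim :: "'b set \<Rightarrow> bool" where
  "fin_dim W \<longleftrightarrow> (\<exists>B. finite B \<and> W \<subseteq> span B)"

lemma fin_dim_subset: "fin_dim W \<Longrightarrow> V \<subseteq> W \<Longrightarrow> fin_dim V"
  unfolding fin_dim_def by blast

lemma fin_dim_Un:
  assumes "fin_dim V" "fin_dim W"
  shows "fin_dim (V \<union> W)"
proof -
  obtain A B where "finite A" "V \<subseteq> span A" "finite B" "W \<subseteq> span B"
    using assms unfolding fin_dim_def by blast
  moreover have "span A \<subseteq> span (A \<union> B)" "span B \<subseteq> span (A \<union> B)"
    by (simp_all add: span_mono)
  ultimately show ?thesis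
    unfolding fin_dim_def by (intro exI[of _ "A \<union> B"]) auto
qed

lemma fin_dim_finite: "finite B \<Longrightarrow> fin_dim B"
  unfolding fin_dim_def by (blast intro: span_base)

lemma fin_dim_independent_finite:
  assumes "fin_dim W" "independent B" "B \<subseteq> W"
  shows "finite B" "card B \<le> dim W"
proof -
  from assms obtain S where S: "finite S" "W \<subseteq> span S"
    unfolding fin_dim_def by blast
  then show "finite B"
    using independent_span_bound[of S B] assms by blast
  obtain C where C: "B \<subseteq> C" "C \<subseteq> W" "independent C" "W \<subseteq> span C"
    using maximal_independent_subset_extend[OF assms(3,2)] by blast
  have "finite C"
    using independent_span_bound[of S C] S C by blast
  then show "card B \<le> dim W"
    using C by (metis basis_card_eq_dim card_mono)
qed

lemma fin_dim_basis:
  assumes "fin_dim W"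
  obtains B where "finite B" "B \<subseteq> W" "independent B" "W \<subseteq> span B" "card B = dim W"
  using basis_exists fin_dim_independent_finite[OF assms] by metis

lemma dim_mono_fin_dim:
  assumes "fin_dim W" "V \<subseteq> W"
  shows "dim V \<le> dim W"
proof -
  obtain B where "B \<subseteq> V" "independent B" "V \<subseteq> span B" "card B = dim V"
    by (rule basis_exists)
  then show ?thesis
    using fin_dim_independent_finite(2)[OF assms(1), of B] assms(2) by simp
qed

lemma dim_insert_fin_dim:
  assumes "fin_dim S"
  shows "dim (insert x S) = (if x \<in> span S then dim S else Suc (dim S))"
proof (cases "x \<in> span S")
  case True
  then show ?thesis by (metis dim_span span_redundant)
next
  case False
  obtain B where B: "finite B" "B \<subseteq> S" "independent B" "S \<subseteq> span B" "card B = dim S"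
    using fin_dim_basis[OF assms] .
  have eq: "span B = span S"
    using B by (intro subset_antisym span_mono span_minimal) auto
  then have x: "x \<notin> span B" using False by simp
  then have "independent (insert x B)" "x \<notin> B"
    using B by (auto simp: independent_insert span_base)
  moreover have "span (insert x B) = span (insert x S)"
    using eq by (simp add: span_insert)
  ultimately show ?thesis
    using B False by (metis card_insert_disjoint dim_eq_card)
qed

lemma subspace_eq_if_dim_ge:
  assumes "fin_dim W" "subspace V" "V \<subseteq> W" "dim W \<le> dim V"
  shows "V = W"
proof (rule ccontr)
  assume "V \<noteq> W"
  then obtain x where x: "x \<in> W" "x \<notin> V" using assms by blast
  then have "dim (insert x V) = Suc (dim V)"
    using dim_insert_fin_dim[OF fin_dim_subset[OF assms(1,3)]] assms(2) by (simp add: span_eq_iff[THEN iffD2])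
  moreover have "dim (insert x V) \<le> dim W"
    using x assms by (intro dim_mono_fin_dim) auto
  ultimately show False using assms by simp
qed

text \<open>Rank-nullity for the map that \<open>f\<close> induces from \<open>W\<close> to the
  quotient by \<open>U\<close>, without forming the quotient: generators \<open>c\<close> of
  \<open>W\<close> are added one at a time, and \<open>c\<close> is new modulo the kernel
  \<open>?K\<close> exactly when \<open>f c\<close> is new modulo \<open>U\<close>.\<close>

lemma dim_image_mod:
  assumes f: "Vector_Spaces.linear scale scale f" and U: "subspace U" "fin_dim U"
    and W: "subspace W" "fin_dim W"
  shows "dim {u + f w | u w. u \<in> U \<and> w \<in> W} + dim {w \<in> W. f w \<in> U} = dim U + dim W"
proof -
  interpret f: Vector_Spaces.linear scale scale f by (rule f)
  let ?K = "{w \<in> W. f w \<in> U}"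
  have K: "subspace ?K"
    using W(1) U(1) unfolding subspace_def by (auto simp: f.add f.scale)
  have fdK: "fin_dim ?K" by (rule fin_dim_subset[OF W(2)]) auto
  have step: "dim (U \<union> f ` C) + dim ?K = dim U + dim (?K \<union> C)" if "finite C" "C \<subseteq> W" for C
    using that
  proof (induction C)
    case (insert c C)
    have fd1: "fin_dim (U \<union> f ` C)" and fd2: "fin_dim (?K \<union> C)"
      using insert.hyps(1) by (auto intro: fin_dim_Un U(2) fdK fin_dim_finite)
    have "f c \<in> span (U \<union> f ` C)" if "c \<in> span (?K \<union> C)"
    proof -
      have "f c \<in> span (f ` (?K \<union> C))"
        using that by (simp add: f.span_image del: image_Un) 
      also have "\<dots> \<subseteq> span (U \<union> f ` C)"
        by (intro span_mono) auto
      finally show ?thesis .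
    qed
    moreover have "c \<in> span (?K \<union> C)" if "f c \<in> span (U \<union> f ` C)"
    proof -
      from that obtain u w where uw: "f c = u + f w" "u \<in> U" "w \<in> span C"
        unfolding span_Un f.span_image using U(1) by (auto simp: span_eq_iff[THEN iffD2])
      then have "w \<in> W"
        using insert.prems W(1) by (metis insert_subset span_minimal subsetD)
      then have "c - w \<in> ?K"
        using uw insert.prems W(1) by (auto simp: f.diff subspace_diff)
      then have "c - w + w \<in> span (?K \<union> C)"
        using uw(3) by (meson Un_upper1 Un_upper2 span_add span_base span_mono subsetD)
      then show ?thesis by simp
    qed
    ultimately have "c \<in> span (?K \<union> C) \<longleftrightarrow> f c \<in> span (U \<union> f ` C)" by blast
    then show ?case
      using insert dim_insert_fin_dim[OF fd1, of "f c"] dim_insert_fin_dim[OF fd2, of c] by auto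
  qed simp
  obtain C where C: "finite C" "C \<subseteq> W" "W \<subseteq> span C"
    using fin_dim_basis[OF W(2)] by metis
  have spC: "span C = W"
    using C W(1) by (intro span_subspace)
  have "span (?K \<union> C) = W"
  proof (rule span_subspace)
    show "W \<subseteq> span (?K \<union> C)"
      unfolding spC[symmetric] by (intro span_mono) auto
  qed (use C W(1) in auto)
  moreover have "span (U \<union> f ` C) = {u + f w | u w. u \<in> U \<and> w \<in> W}"
    unfolding span_Un f.span_image spC using U(1) by (auto simp: span_eq_iff[THEN iffD2])
  ultimately show ?thesis
    using step[OF C(1,2)] by (metis dim_span)
qed

section \<open>Linear functionals and families of vectors depending on parameters\<close>

lemma functional_exists:
  assumes U: "subspace U" and v: "v \<notin> U"
  obtains \<phi> where "Vector_Spaces.linear scale (*) \<phi>" "\<And>u. u \<in> U \<Longrightarrow> \<phi> u = 0" "\<phi> v = 1"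
proof -
  interpret K: vector_space "(*) :: 'a \<Rightarrow> 'a \<Rightarrow> 'a"
    by unfold_locales (auto simp: algebra_simps)
  interpret vector_space_pair scale "(*) :: 'a \<Rightarrow> 'a \<Rightarrow> 'a" ..
  obtain A where A: "A \<subseteq> U" "independent A" "U \<subseteq> span A" "card A = dim U"
    by (rule basis_exists)
  then have sp: "span A = U" using U by (intro span_subspace)
  then have "independent (insert v A)" using A v by (simp add: independent_insert)
  from linear_independent_extend[OF this, of "\<lambda>x. if x = v then 1 else 0"]
  obtain \<phi> where \<phi>: "Vector_Spaces.linear scale (*) \<phi>" "\<forall>x\<in>insert v A. \<phi> x = (if x = v then 1 else 0)"
    by blast
  interpret \<phi>: Vector_Spaces.linear scale "(*) :: 'a \<Rightarrow> 'a \<Rightarrow> 'a" \<phi> by (rule \<phi>)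
  have "\<phi> u = 0" if "u \<in> U" for u
    using that unfolding sp[symmetric]
  proof (induction rule: span_induct_alt)
    case (step c x y)
    then have "x \<noteq> v" using v sp span_base by blast
    then show ?case using step \<phi>(2) by (simp add: \<phi>.add \<phi>.scale)
  qed (rule \<phi>.zero)
  then show thesis using that \<phi> by auto
qed

text \<open>A functional vanishing on \<open>U\<close> but not at \<open>v i\<close> would turn the
  family into a nonzero polynomial in \<open>s\<close> with infinitely many roots.\<close>

lemma polynomial_curve_in_subspace:
  assumes U: "subspace U" and inf: "infinite {s. (\<Sum>i\<le>n. scale (s ^ i) (v i)) \<in> U}" and i: "i \<le> n"
  shows "v i \<in> U"
proof (rule ccontr)
  assume "v i \<notin> U"
  from functional_exists[OF U this] obtain \<phi> where \<phi>: "Vector_Spaces.linear scale (*) \<phi>"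
    "\<And>u. u \<in> U \<Longrightarrow> \<phi> u = 0" "\<phi> (v i) = 1" by metis
  interpret \<phi>: Vector_Spaces.linear scale "(*) :: 'a \<Rightarrow> 'a \<Rightarrow> 'a" \<phi> by (rule \<phi>)
  define p where "p = (\<Sum>j\<le>n. Polynomial.monom (\<phi> (v j)) j)"
  have "poly p s = 0" if "(\<Sum>i\<le>n. scale (s ^ i) (v i)) \<in> U" for s
  proof -
    have "poly p s = \<phi> (\<Sum>i\<le>n. scale (s ^ i) (v i))"
      by (simp add: p_def Polynomial.poly_sum Polynomial.poly_monom \<phi>.sum \<phi>.scale mult.commute)
    then show ?thesis using \<phi>(2)[OF that] by simp
  qed
  then have "infinite {s. poly p s = 0}"
    using inf by (rule_tac infinite_super[rotated]) auto
  then have "p = 0" using poly_roots_finite by blast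
  moreover have "Polynomial.coeff p i = 1"
    using i \<phi>(3) by (simp add: p_def Polynomial.coeff_sum Polynomial.coeff_monom sum.delta' )
  ultimately show False by simp
qed

text \<open>Linear independence modulo a subspace is an open condition; the function \<open>F\<close> is the
  product of the pivots of a Gaussian elimination carried out at \<open>t\<^sub>0\<close>.\<close>

lemma independent_mod_open:
  fixes u :: "nat \<Rightarrow> 't \<Rightarrow> 'b"
  assumes one: "(\<lambda>_. 1) \<in> P" and mult: "\<And>f g. f \<in> P \<Longrightarrow> g \<in> P \<Longrightarrow> (\<lambda>t. f t * g t) \<in> P"
    and diff: "\<And>f g. f \<in> P \<Longrightarrow> g \<in> P \<Longrightarrow> (\<lambda>t. f t - g t) \<in> P"
    and U: "subspace U"
    and u: "\<And>i \<phi>. i < m \<Longrightarrow> Vector_Spaces.linear scale (*) \<phi> \<Longrightarrow> (\<lambda>t. \<phi> (u i t)) \<in> P"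
    and ind: "\<And>c. (\<Sum>i<m. scale (c i) (u i t\<^sub>0)) \<in> U \<Longrightarrow> \<forall>i<m. c i = 0"
  shows "\<exists>F\<in>P. F t\<^sub>0 \<noteq> 0 \<and> (\<forall>t. F t \<noteq> 0 \<longrightarrow> (\<forall>c. (\<Sum>i<m. scale (c i) (u i t)) \<in> U \<longrightarrow> (\<forall>i<m. c i = 0)))"
  using u ind
proof (induction m arbitrary: u)
  case 0
  show ?case by (rule bexI[OF _ one]) simp
next
  case (Suc m)
  have "u m t\<^sub>0 \<notin> U"
  proof
    assume *: "u m t\<^sub>0 \<in> U"
    have "(\<Sum>i<Suc m. scale (if i = m then 1 else 0) (u i t\<^sub>0)) = (\<Sum>i<Suc m. if i = m then u i t\<^sub>0 else 0)"
      by (rule sum.cong) auto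
    also have "\<dots> = u m t\<^sub>0" by simp
    finally show False
      using Suc.prems(2)[of "\<lambda>i. if i = m then 1 else 0"] * by auto
  qed
  from functional_exists[OF U this] obtain \<phi> where \<phi>: "Vector_Spaces.linear scale (*) \<phi>"
    "\<And>u. u \<in> U \<Longrightarrow> \<phi> u = 0" "\<phi> (u m t\<^sub>0) = 1" by metis
  interpret \<phi>: Vector_Spaces.linear scale "(*) :: 'a \<Rightarrow> 'a \<Rightarrow> 'a" \<phi> by (rule \<phi>)
  \<comment> \<open>Elimination without division: \<phi> vanishes on every \<open>w i t\<close>, and
    the coordinates of \<open>w\<close> remain in \<open>P\<close>.\<close>
  define w where "w i t = scale (\<phi> (u m t)) (u i t) - scale (\<phi> (u i t)) (u m t)" for i t
  have w_sum: "(\<Sum>i<m. scale (c i) (w i t)) =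
      scale (\<phi> (u m t)) (\<Sum>i<m. scale (c i) (u i t)) - scale (\<Sum>i<m. c i * \<phi> (u i t)) (u m t)" for c t
    by (simp add: w_def scale_right_diff_distrib sum_subtractf scale_sum_right scale_sum_left mult.commute)
  have "\<exists>F\<in>P. F t\<^sub>0 \<noteq> 0 \<and> (\<forall>t. F t \<noteq> 0 \<longrightarrow> (\<forall>c. (\<Sum>i<m. scale (c i) (w i t)) \<in> U \<longrightarrow> (\<forall>i<m. c i = 0)))"
  proof (rule Suc.IH)
    fix i \<psi> assume i: "i < m" and \<psi>: "Vector_Spaces.linear scale (*) \<psi>"
    interpret \<psi>: Vector_Spaces.linear scale "(*) :: 'a \<Rightarrow> 'a \<Rightarrow> 'a" \<psi> by (rule \<psi>)
    have "(\<lambda>t. \<phi> (u m t) * \<psi> (u i t) - \<phi> (u i t) * \<psi> (u m t)) \<in> P"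
      using i \<phi>(1) \<psi> by (intro diff mult Suc.prems(1)) auto
    then show "(\<lambda>t. \<psi> (w i t)) \<in> P"
      by (simp add: w_def \<psi>.diff \<psi>.scale)
  next
    fix c assume *: "(\<Sum>i<m. scale (c i) (w i t\<^sub>0)) \<in> U"
    \<comment> \<open>The coefficient at \<open>m\<close> is read off from \<open>w_sum\<close>; the
      pivot is 1 at \<open>t\<^sub>0\<close>.\<close>
    define c' where "c' i = (if i = m then - (\<Sum>i<m. c i * \<phi> (u i t\<^sub>0)) else c i)" for i
    have "(\<Sum>i<Suc m. scale (c' i) (u i t\<^sub>0)) = (\<Sum>i<m. scale (c i) (w i t\<^sub>0))"
      unfolding w_sum by (simp add: c'_def \<phi>(3))
    then have "\<forall>i<Suc m. c' i = 0"
      using Suc.prems(2) * by metis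
    then show "\<forall>i<m. c i = 0"
      by (metis c'_def less_Suc_eq less_irrefl)
  qed
  then obtain F where F: "F \<in> P" "F t\<^sub>0 \<noteq> 0"
    "\<And>t c. F t \<noteq> 0 \<Longrightarrow> (\<Sum>i<m. scale (c i) (w i t)) \<in> U \<Longrightarrow> \<forall>i<m. c i = 0" by blast
  show ?case
  proof (intro bexI[of _ "\<lambda>t. F t * \<phi> (u m t)"] conjI allI impI)
    show "(\<lambda>t. F t * \<phi> (u m t)) \<in> P"
      using F \<phi>(1) by (intro mult Suc.prems(1)) auto
    show "F t\<^sub>0 * \<phi> (u m t\<^sub>0) \<noteq> 0" using F \<phi>(3) by simp
    fix t c i
    assume t: "F t * \<phi> (u m t) \<noteq> 0" and c: "(\<Sum>i<Suc m. scale (c i) (u i t)) \<in> U" and i: "i < Suc m"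
    have "(\<Sum>i<m. c i * \<phi> (u i t)) + c m * \<phi> (u m t) = 0"
      using \<phi>(2)[OF c] by (simp add: \<phi>.sum \<phi>.scale \<phi>.add)
    then have "(\<Sum>i<m. c i * \<phi> (u i t)) = - (c m * \<phi> (u m t))"
      by (simp add: eq_neg_iff_add_eq_0)
    then have "(\<Sum>i<m. scale (c i) (w i t)) = scale (\<phi> (u m t)) (\<Sum>i<Suc m. scale (c i) (u i t))"
      unfolding w_sum by (simp add: scale_right_distrib mult.commute)
    also have "\<dots> \<in> U" using c U by (rule_tac subspace_scale)
    finally have 0: "\<forall>i<m. c i = 0" using F(3) t by auto
    then have "scale (c m) (u m t) \<in> U" using c by simp
    from \<phi>(2)[OF this] have "c m = 0" using t by (simp add: \<phi>.scale)
    then show "c i = 0" using 0 i by (auto simp: less_Suc_eq)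
  qed
qed

end

section \<open>Hilbert functions of graded ideals\<close>

text \<open>The Hilbert function arguments only see the graded pieces of an algebra generated in
  degree one over an infinite field; \<open>graded_algebra_forms\<close> supplies the polynomial
  ring.\<close>

locale graded_algebra = linear_space scale
  for scale :: "'a::field \<Rightarrow> 'b::comm_ring_1 \<Rightarrow> 'b" +
  fixes R :: "nat \<Rightarrow> 'b set" and x :: "nat \<Rightarrow> 'b" and n :: nat
  assumes scale_mult: "scale c p * q = scale c (p * q)"
    and infinite_field: "infinite (UNIV :: 'a set)"
    and subspace_R: "subspace (R d)"
    and fin_dim_R0: "fin_dim (R 0)"
    and x_mult_R: "i \<le> n \<Longrightarrow> p \<in> R d \<Longrightarrow> x i * p \<in> R (Suc d)"
    and R_Suc: "R (Suc d) \<subseteq> span {x i * p | i p. i \<le> n \<and> p \<in> R d}"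
begin

definition lin :: "(nat \<Rightarrow> 'a) \<Rightarrow> 'b" where
  "lin a = (\<Sum>i\<le>n. scale (a i) (x i))"

text \<open>Points of a moment curve serve as general linear forms: being in general position then means
  avoiding finitely many values of the parameter.\<close>

definition curve :: "'a \<Rightarrow> 'b" where
  "curve s = lin (\<lambda>i. s ^ i)"

text \<open>A graded ideal is given by the family of its homogeneous components.\<close>

definition graded_ideal :: "(nat \<Rightarrow> 'b set) \<Rightarrow> bool" where
  "graded_ideal I \<longleftrightarrow> (\<forall>d. subspace (I d) \<and> I d \<subseteq> R d) \<and>
     (\<forall>d. \<forall>i\<le>n. \<forall>p\<in>I d. x i * p \<in> I (Suc d))"

text \<open>The pieces of the ideal (I,h) for \<open>h\<close> of degree one; multiples of
  \<open>h\<close> start in degree one, so the multiplier in degree 0 is 0.\<close>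

definition add_gen :: "(nat \<Rightarrow> 'b set) \<Rightarrow> 'b \<Rightarrow> nat \<Rightarrow> 'b set" where
  "add_gen I h d = {p + h * q | p q. p \<in> I d \<and> q \<in> (case d of 0 \<Rightarrow> {0} | Suc e \<Rightarrow> R e)}"

definition colon :: "(nat \<Rightarrow> 'b set) \<Rightarrow> 'b \<Rightarrow> nat \<Rightarrow> 'b set" where
  "colon I h d = {q \<in> R d. h * q \<in> I (Suc d)}"

text \<open>For graded ideals the truncated subtraction is exact, as each \<open>R d\<close> is
  finite-dimensional.\<close>

definition hf :: "(nat \<Rightarrow> 'b set) \<Rightarrow> nat \<Rightarrow> nat" where
  "hf I d = dim (R d) - dim (I d)"

definition saturated :: "(nat \<Rightarrow> 'b set) \<Rightarrow> bool" where
  "saturated I \<longleftrightarrow> (\<forall>d. \<forall>p\<in>R d. (\<forall>i\<le>n. x i * p \<in> I (Suc d)) \<longrightarrow> p \<in> I d)"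

section \<open>Sums with a linear form, colons and the exact sequence\<close>

lemma mult_scale: "q * scale c p = scale c (q * p)"
  by (metis mult.commute scale_mult)

lemma linear_mult: "Vector_Spaces.linear scale scale ((*) h)"
  by (simp add: Vector_Spaces.linear_iff mult_scale distrib_left vector_space_axioms)

lemma fin_dim_R: "fin_dim (R d)"
proof (induction d)
  case (Suc d)
  then obtain B where B: "finite B" "R d \<subseteq> span B"
    unfolding fin_dim_def by blast
  have "x i * p \<in> span (\<Union>i\<le>n. (*) (x i) ` B)" if "i \<le> n" "p \<in> R d" for i p
  proof -
    interpret h: Vector_Spaces.linear scale scale "(*) (x i)" by (rule linear_mult)
    have "x i * p \<in> span ((*) (x i) ` B)"
      unfolding h.span_image using B that by auto
    also have "\<dots> \<subseteq> span (\<Union>i\<le>n. (*) (x i) ` B)"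
      using that by (intro span_mono) auto
    finally show ?thesis .
  qed
  then have "R (Suc d) \<subseteq> span (\<Union>i\<le>n. (*) (x i) ` B)"
    by (intro order_trans[OF R_Suc] span_minimal) auto
  then show ?case
    unfolding fin_dim_def using B(1) by (intro exI[of _ "\<Union>i\<le>n. (*) (x i) ` B"]) auto
qed (rule fin_dim_R0)

lemma lin_mult: "lin a * p = (\<Sum>i\<le>n. scale (a i) (x i * p))"
  by (simp add: lin_def sum_distrib_right scale_mult)

lemma lin_mult_R: "p \<in> R d \<Longrightarrow> lin a * p \<in> R (Suc d)"
  unfolding lin_mult by (intro subspace_sum subspace_scale subspace_R x_mult_R) auto

lemma curve_mult_R: "p \<in> R d \<Longrightarrow> curve s * p \<in> R (Suc d)"
  unfolding curve_def by (rule lin_mult_R)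

lemma
  assumes "graded_ideal I"
  shows graded_ideal_subspace: "subspace (I d)"
    and graded_ideal_subset: "I d \<subseteq> R d"
    and graded_ideal_x: "i \<le> n \<Longrightarrow> p \<in> I d \<Longrightarrow> x i * p \<in> I (Suc d)"
  using assms unfolding graded_ideal_def by auto

lemma graded_ideal_fin_dim: "graded_ideal I \<Longrightarrow> fin_dim (I d)"
  using fin_dim_R fin_dim_subset graded_ideal_subset by blast

lemma graded_ideal_lin:
  assumes "graded_ideal I" "p \<in> I d"
  shows "lin a * p \<in> I (Suc d)"
  unfolding lin_mult
  using assms by (intro subspace_sum subspace_scale graded_ideal_subspace graded_ideal_x) auto

lemma graded_ideal_add_gen:
  assumes I: "graded_ideal I"
  shows "graded_ideal (add_gen I (lin a))"
proof -
  let ?P = "\<lambda>d. case d of 0 \<Rightarrow> {0} | Suc e \<Rightarrow> R e"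
  have P: "subspace (?P d)" for d
    by (cases d) (auto intro: subspace_R)
  have "subspace (add_gen I (lin a) d)" for d
  proof -
    interpret h: Vector_Spaces.linear scale scale "(*) (lin a)" by (rule linear_mult)
    have "subspace {p + q | p q. p \<in> I d \<and> q \<in> (*) (lin a) ` ?P d}"
      by (intro subspace_sums graded_ideal_subspace[OF I] h.subspace_image P)
    moreover have "{p + q | p q. p \<in> I d \<and> q \<in> (*) (lin a) ` ?P d} = add_gen I (lin a) d"
      by (auto simp: add_gen_def)
    ultimately show ?thesis by simp
  qed
  moreover have "add_gen I (lin a) d \<subseteq> R d" for d
  proof (cases d)
    case 0
    then show ?thesis using graded_ideal_subset[OF I] by (auto simp: add_gen_def)
  next
    case (Suc e)
    then show ?thesis
      using graded_ideal_subset[OF I] lin_mult_R by (auto simp: add_gen_def intro!: subspace_add subspace_R)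
  qed
  moreover have "x i * r \<in> add_gen I (lin a) (Suc d)" if "i \<le> n" "r \<in> add_gen I (lin a) d" for i d r
  proof -
    from that(2) obtain p q where pq: "r = p + lin a * q" "p \<in> I d" "q \<in> ?P d"
      by (auto simp: add_gen_def)
    have "x i * r = x i * p + lin a * (x i * q)"
      by (simp add: pq algebra_simps)
    moreover have "x i * q \<in> R d"
      using pq(3) that(1) subspace_0[OF subspace_R] by (cases d) (auto intro: x_mult_R)
    ultimately show ?thesis
      using graded_ideal_x[OF I that(1) pq(2)] by (auto simp: add_gen_def)
  qed
  ultimately show ?thesis by (simp add: graded_ideal_def)
qed

lemma graded_ideal_colon:
  assumes I: "graded_ideal I"
  shows "graded_ideal (colon I h)"
proof -
  have "subspace (colon I h d)" for d
    using graded_ideal_subspace[OF I, of "Suc d"] subspace_R[of d]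
    by (auto simp: colon_def subspace_def distrib_left mult_scale)
  moreover have "x i * p \<in> colon I h (Suc d)" if "i \<le> n" "p \<in> colon I h d" for i d p
    using that graded_ideal_x[OF I that(1), of "h * p" "Suc d"] x_mult_R
    by (auto simp: colon_def mult.left_commute)
  ultimately show ?thesis by (auto simp: graded_ideal_def colon_def)
qed

lemma graded_ideal_subset_colon: "graded_ideal I \<Longrightarrow> I d \<subseteq> colon I (lin a) d"
  using graded_ideal_subset graded_ideal_lin by (fastforce simp: colon_def)

text \<open>Multiplication by \<open>lin a\<close> commutes with that by the variables. This keeps
  the induction in \<open>finite_curve_zero_divisors\<close> within saturated ideals.\<close>

lemma saturated_colon:
  assumes I: "graded_ideal I" "saturated I"
  shows "saturated (colon I (lin a))"
  unfolding saturated_def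
proof (intro allI ballI impI)
  fix d p assume p: "p \<in> R d" "\<forall>i\<le>n. x i * p \<in> colon I (lin a) (Suc d)"
  then have "\<forall>i\<le>n. x i * (lin a * p) \<in> I (Suc (Suc d))"
    by (auto simp: colon_def mult.left_commute)
  then show "p \<in> colon I (lin a) d"
    using I(2) p(1) lin_mult_R by (auto simp: saturated_def colon_def)
qed

lemma dim_le_dim_R: "graded_ideal I \<Longrightarrow> dim (I d) \<le> dim (R d)"
  by (intro dim_mono_fin_dim fin_dim_R graded_ideal_subset)

lemma hf_antimono:
  assumes "graded_ideal J" "I d \<subseteq> J d"
  shows "hf J d \<le> hf I d"
  unfolding hf_def using assms by (intro diff_le_mono2 dim_mono_fin_dim graded_ideal_fin_dim)

lemma graded_ideal_eq_if_hf_le: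
  assumes I: "graded_ideal I" and J: "graded_ideal J" and IJ: "I d \<subseteq> J d" and le: "hf I d \<le> hf J d"
  shows "I d = J d"
proof (rule subspace_eq_if_dim_ge)
  show "dim (J d) \<le> dim (I d)"
    using le dim_le_dim_R[OF I, of d] dim_le_dim_R[OF J, of d] by (simp add: hf_def)
qed (use assms in \<open>auto intro: graded_ideal_subspace graded_ideal_fin_dim\<close>)

lemma hf_eq_0: 
  assumes "graded_ideal I"
  shows "hf I d = 0 \<longleftrightarrow> I d = R d"
proof
  assume "hf I d = 0"
  then show "I d = R d"
    by (intro subspace_eq_if_dim_ge fin_dim_R graded_ideal_subspace graded_ideal_subset assms)
      (simp add: hf_def)
qed (simp add: hf_def)

text \<open>The sequence 0 -> R/(I:h)(-1) -> R/I -> R/(I,h) -> 0 in degree \<open>Suc d\<close>: the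
  colon is the kernel of multiplication by \<open>h\<close> modulo \<open>I\<close>, as in
  \<open>dim_image_mod\<close>.\<close>

lemma hf_exact:
  assumes I: "graded_ideal I"
  shows "hf I (Suc d) = hf (colon I (lin a)) d + hf (add_gen I (lin a)) (Suc d)"
proof -
  have "dim (add_gen I (lin a) (Suc d)) + dim (colon I (lin a) d) = dim (I (Suc d)) + dim (R d)"
    using dim_image_mod[OF linear_mult[of "lin a"] graded_ideal_subspace[OF I] graded_ideal_fin_dim[OF I]
        subspace_R fin_dim_R, of "Suc d" d]
    by (simp add: add_gen_def colon_def)
  then show ?thesis
    using dim_le_dim_R[OF I, of "Suc d"] dim_le_dim_R[OF graded_ideal_colon[OF I], of "lin a" d]
      dim_le_dim_R[OF graded_ideal_add_gen[OF I], of a "Suc d"]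
    unfolding hf_def by linarith
qed

section \<open>Specialization along the moment curve, Green's theorem and Macaulay's bound\<close>

lemma curve_annihilates:
  assumes I: "graded_ideal I" and inf: "infinite {s. curve s * p \<in> I d}" and i: "i \<le> n"
  shows "x i * p \<in> I d"
  using inf unfolding curve_def lin_mult
  by (rule polynomial_curve_in_subspace[OF graded_ideal_subspace[OF I] _ i])

text \<open>If infinitely many \<open>curve s\<close> multiplied \<open>R d\<close> into
  \<open>I\<close>, so would every variable, and these products span
  \<open>R (Suc d)\<close>.\<close>

lemma finite_colon_curve_eq_R:
  assumes I: "graded_ideal I" and ne: "I (Suc d) \<noteq> R (Suc d)"
  shows "finite {s. colon I (curve s) d = R d}"
proof (rule ccontr)
  assume inf: "infinite {s. colon I (curve s) d = R d}"
  have "x i * p \<in> I (Suc d)" if "i \<le> n" "p \<in> R d" for i p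
  proof (rule curve_annihilates[OF I _ that(1)])
    show "infinite {s. curve s * p \<in> I (Suc d)}"
      using that by (intro infinite_super[OF _ inf]) (auto simp: colon_def)
  qed
  then have "R (Suc d) \<subseteq> I (Suc d)"
    by (intro order_trans[OF R_Suc] span_minimal graded_ideal_subspace[OF I]) auto
  then show False using ne graded_ideal_subset[OF I] by blast
qed

text \<open>Green's theorem. If it failed for infinitely many \<open>s\<close>, choose such an \<open>s\<close> that minimizes the
  left-hand side; restricting the sequence
  $0 \to R/(I:h)(-1) \to R/I \to R/(I,h) \to 0$ for \<open>h = curve s\<close> to \<open>curve s'\<close>, for another
  bad \<open>s'\<close>, and induction then contradict \<open>green_numeric\<close>.\<close>

theorem green:
  assumes "graded_ideal I" "d > 0"
  shows "finite {s. tlow d (mac d (hf I d)) < hf (add_gen I (curve s)) d}"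
  using assms(2,1)
proof (induction d arbitrary: I rule: nat_induct_non_zero)
  case 1
  then have I: "graded_ideal I" by simp
  show ?case
  proof (cases "I 1 = R 1")
    case True
    then have "hf I 1 = 0" by (simp add: hf_def)
    then have "hf (add_gen I (curve s)) 1 = 0" for s
      using hf_exact[OF I, of 0 "\<lambda>i. s ^ i" for s] by (simp add: curve_def)
    then show ?thesis by simp
  next
    case False
    have "hf (add_gen I (curve s)) 1 \<le> tlow 1 (mac 1 (hf I 1))" if "colon I (curve s) 0 \<noteq> R 0" for s
    proof -
      have "hf (colon I (curve s)) 0 > 0"
        using that hf_eq_0[OF graded_ideal_colon[OF I]] by blast
      then have c: "hf (add_gen I (curve s)) 1 < hf I 1"
        using hf_exact[OF I, of 0 "\<lambda>i. s ^ i"] by (simp add: curve_def)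
      \<comment> \<open>In degree one a positive c lowers to c - 1, so a drop of the dimension by
        one suffices.\<close>
      then have "mac 1 (hf I 1) = [hf I 1 - 1]"
        by (intro mac_eqI) (auto simp: tuple_def)
      then show ?thesis using c by simp
    qed
    then have "{s. tlow 1 (mac 1 (hf I 1)) < hf (add_gen I (curve s)) 1} \<subseteq> {s. colon I (curve s) 0 = R 0}"
      by (auto simp: not_less[symmetric])
    then show ?thesis
      using finite_colon_curve_eq_R[OF I, of 0] False finite_subset by (metis One_nat_def)
  qed
next
  case (Suc e)
  note outer = Suc.IH and e = \<open>e > 0\<close>
  from Suc.prems show ?case
  \<comment> \<open>Two nested inductions: the colon \<open>K\<close> is used one degree lower,
    while the sum \<open>J\<close> stays in degree \<open>Suc e\<close> with a smaller Hilbert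
    function.\<close>
  proof (induction "hf I (Suc e)" arbitrary: I rule: less_induct)
    case less
    note I = less.prems
    let ?c = "\<lambda>s. hf (add_gen I (curve s)) (Suc e)"
    let ?low = "\<lambda>d c. tlow d (mac d c)"
    show ?case
    proof (rule ccontr)
      assume inf: "infinite {s. ?low (Suc e) (hf I (Suc e)) < ?c s}"
      then obtain s0 where "?low (Suc e) (hf I (Suc e)) < ?c s0"
        by (metis (mono_tags, lifting) Collect_empty_eq finite.emptyI)
      then have "hf I (Suc e) > 0"
        using hf_exact[OF I, of e "\<lambda>i. s0 ^ i"] by (simp add: curve_def)
      then have "I (Suc e) \<noteq> R (Suc e)" using hf_eq_0[OF I] by force
      then have fin0: "finite {s. colon I (curve s) e = R e}"
        by (rule finite_colon_curve_eq_R[OF I])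
      \<comment> \<open>Excluding the parameters whose colon is all of \<open>R e\<close> makes
        \<open>hf K e\<close> positive, hence \<open>hf J (Suc e)\<close> smaller than
        \<open>hf I (Suc e)\<close>.\<close>
      define B where "B = {s. ?low (Suc e) (hf I (Suc e)) < ?c s} - {s. colon I (curve s) e = R e}"
      have infB: "infinite B" unfolding B_def using inf fin0 by simp
      then obtain s1 where "s1 \<in> B" by (metis ex_in_conv finite.emptyI)
      then obtain s where s: "s \<in> B" "\<And>s'. s' \<in> B \<Longrightarrow> ?c s \<le> ?c s'"
        using ex_has_least_nat[of "\<lambda>s. s \<in> B" s1 ?c] by blast
      define J K where "J = add_gen I (curve s)" and "K = colon I (curve s)"
      have J: "graded_ideal J" unfolding J_def curve_def by (rule graded_ideal_add_gen[OF I])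
      have K: "graded_ideal K" unfolding K_def by (rule graded_ideal_colon[OF I])
      have sum: "hf I (Suc e) = hf K e + hf J (Suc e)"
        unfolding J_def K_def curve_def by (rule hf_exact[OF I])
      have "hf K e > 0"
        using s(1) hf_eq_0[OF K] unfolding B_def K_def by auto
      then have finJ: "finite {s'. ?low (Suc e) (hf J (Suc e)) < hf (add_gen J (curve s')) (Suc e)}"
        using sum by (intro less.hyps J) simp
      have finK: "finite {s'. ?low e (hf K e) < hf (add_gen K (curve s')) e}"
        by (rule outer[OF K])
      obtain s' where s': "s' \<in> B" "hf (add_gen J (curve s')) (Suc e) \<le> ?low (Suc e) (hf J (Suc e))"
        "hf (add_gen K (curve s')) e \<le> ?low e (hf K e)"
      proof -
        have "infinite (B - {s'. ?low (Suc e) (hf J (Suc e)) < hf (add_gen J (curve s')) (Suc e)}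
          - {s'. ?low e (hf K e) < hf (add_gen K (curve s')) e})"
          using infB finJ finK by simp
        then obtain s' where "s' \<in> B - {s'. ?low (Suc e) (hf J (Suc e)) < hf (add_gen J (curve s')) (Suc e)}
          - {s'. ?low e (hf K e) < hf (add_gen K (curve s')) e}"
          by (metis ex_in_conv finite.emptyI)
        then show thesis using that[of s'] by (auto simp: not_less)
      qed
      define L where "L = add_gen I (curve s')"
      have L: "graded_ideal L" unfolding L_def curve_def by (rule graded_ideal_add_gen[OF I])
      \<comment> \<open>The inclusion of (I:h) + (h') in (I + (h')):h, which bounds the colon term
        in the exact sequence of \<open>L\<close>.\<close>
      have "add_gen K (curve s') e \<subseteq> colon L (curve s) e"
      proof
        fix r assume "r \<in> add_gen K (curve s') e"
        then obtain p q where r: "r = p + curve s' * q" "p \<in> R e" "curve s * p \<in> I (Suc e)"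
          "q \<in> (case e of 0 \<Rightarrow> {0} | Suc e \<Rightarrow> R e)"
          by (auto simp: add_gen_def K_def colon_def)
        from r(4) e obtain f where f: "e = Suc f" "q \<in> R f" by (cases e) auto
        have "curve s * r = curve s * p + curve s' * (curve s * q)"
          by (simp add: r(1) algebra_simps)
        then have "curve s * r \<in> L (Suc e)"
          using r(3) f curve_mult_R[of q f s] unfolding L_def add_gen_def by auto
        moreover have "r \<in> R e"
          unfolding r(1) using r(2) f curve_mult_R[of q f s'] by (auto intro: subspace_add subspace_R)
        ultimately show "r \<in> colon L (curve s) e" by (simp add: colon_def)
      qed
      then have 1: "hf (colon L (curve s)) e \<le> hf (add_gen K (curve s')) e"
        by (intro hf_antimono graded_ideal_colon[OF L])
      have comm: "add_gen (add_gen I h) h' d \<subseteq> add_gen (add_gen I h') h d" for h h' d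
      proof
        fix r assume "r \<in> add_gen (add_gen I h) h' d"
        then obtain p q q' where "r = p + h * q + h' * q'" "p \<in> I d"
          and q: "q \<in> (case d of 0 \<Rightarrow> {0} | Suc e \<Rightarrow> R e)" "q' \<in> (case d of 0 \<Rightarrow> {0} | Suc e \<Rightarrow> R e)"
          unfolding add_gen_def by blast
        then have r: "r = (p + h' * q') + h * q" and p: "p + h' * q' \<in> add_gen I h' d"
          by (simp add: algebra_simps) (use q \<open>p \<in> I d\<close> in \<open>unfold add_gen_def, blast\<close>)
        show "r \<in> add_gen (add_gen I h') h d"
          unfolding add_gen_def[of "add_gen I h'"] using r p q(1) by blast
      qed
      have "add_gen L (curve s) (Suc e) = add_gen J (curve s') (Suc e)"
        unfolding L_def J_def by (intro subset_antisym comm)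
      then have 2: "hf (add_gen L (curve s)) (Suc e) = hf (add_gen J (curve s')) (Suc e)"
        by (simp add: hf_def)
      \<comment> \<open>Minimality of \<open>s\<close> enters here, comparing the quotients by
        \<open>curve s\<close> and \<open>curve s'\<close>.\<close>
      have "hf J (Suc e) \<le> hf L (Suc e)"
        using s(2)[OF s'(1)] by (simp add: J_def L_def)
      also have "\<dots> \<le> ?low e (hf K e) + ?low (Suc e) (hf J (Suc e))"
        using 1 2 s'(2,3) hf_exact[OF L, of e "\<lambda>i. s ^ i"] by (simp add: curve_def)
      finally have "tval (Suc e) (mac (Suc e) (hf J (Suc e))) \<le> ?low (Suc e) (hf I (Suc e))"
        using e sum by (intro green_numeric[where f = "mac e (hf K e)"]) auto
      then show False
        using s(1) by (simp add: B_def J_def)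
    qed
  qed
qed

text \<open>In the exact sequence for a general h the colon contains \<open>I\<close> and so
  contributes at most \<open>hf I d\<close>, and Green's theorem bounds the other term by the
  lowered number. The difference of c = \<open>hf I (Suc d)\<close> and its lowered number
  remains.\<close>

theorem macaulay:
  assumes I: "graded_ideal I"
  shows "tdiff (Suc d) (mac (Suc d) (hf I (Suc d))) \<le> hf I d"
proof -
  let ?a = "mac (Suc d) (hf I (Suc d))"
  from green[OF I, of "Suc d"] infinite_field
  obtain s where "hf (add_gen I (curve s)) (Suc d) \<le> tlow (Suc d) ?a"
    by (metis (mono_tags, lifting) UNIV_eq_I mem_Collect_eq not_le zero_less_Suc)
  moreover have "hf (colon I (curve s)) d \<le> hf I d"
    unfolding curve_def by (intro hf_antimono graded_ideal_colon I graded_ideal_subset_colon)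
  moreover have "hf I (Suc d) = hf (colon I (curve s)) d + hf (add_gen I (curve s)) (Suc d)"
    unfolding curve_def by (rule hf_exact[OF I])
  moreover have "hf I (Suc d) = tlow (Suc d) ?a + tdiff (Suc d) ?a"
    using tval_eq[of ?a "Suc d"] tuple_mac[of "Suc d" "hf I (Suc d)"] by (simp add: tuple_def)
  ultimately show ?thesis by linarith
qed

text \<open>As \<open>tdiff (Suc d) T\<close> is the value of \<open>T\<close> in degree
  \<open>d\<close>, lower bounds pass downwards, even to degree \<open>length T - 1\<close>.\<close>

lemma macaulay_down:
  assumes I: "graded_ideal I" and T: "tuple (Suc d) T" and le: "tval (Suc d) T \<le> hf I (Suc d)"
  shows "tval d T \<le> hf I d"
proof -
  have "tdiff (Suc d) T \<le> tdiff (Suc d) (mac (Suc d) (hf I (Suc d)))"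
    using tlow_tdiff_mono[OF T tuple_mac] le by simp
  then show ?thesis
    using macaulay[OF I, of d] T by (simp add: tuple_def tdiff_eq_tval)
qed

lemma macaulay_up:
  assumes I: "graded_ideal I" and T: "tuple d T" and le: "hf I d \<le> tval d T"
  shows "hf I (Suc d) \<le> tval (Suc d) T"
  using tval_growth[OF T tuple_mac, of "hf I (Suc d)"] macaulay[OF I, of d] le by simp

text \<open>If infinitely many \<open>curve s\<close> were zero divisors, their annihilators in \<open>R/I\<close> would
  eventually agree, and a common element would be killed by all variables.\<close>

lemma finite_curve_zero_divisors:
  assumes "graded_ideal I" "saturated I"
  shows "finite {s. colon I (curve s) e \<noteq> I e}"
  using assms
proof (induction "hf I e" arbitrary: I rule: less_induct)
  case less
  note I = less.prems
  let ?K = "\<lambda>s. colon I (curve s)"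
  have K: "graded_ideal (?K s)" "saturated (?K s)" "I e \<subseteq> ?K s e" for s
    unfolding curve_def
    by (rule graded_ideal_colon[OF I(1)], rule saturated_colon[OF I], rule graded_ideal_subset_colon[OF I(1)])
  show ?case
  proof (rule ccontr)
    assume inf: "infinite {s. ?K s e \<noteq> I e}"
    then obtain s1 where "?K s1 e \<noteq> I e"
      by (metis (mono_tags, lifting) Collect_empty_eq finite.emptyI)
    then obtain s where s: "?K s e \<noteq> I e" "\<And>s'. ?K s' e \<noteq> I e \<Longrightarrow> dim (?K s e) \<le> dim (?K s' e)"
      using ex_has_least_nat[of "\<lambda>s. ?K s e \<noteq> I e" s1 "\<lambda>s. dim (?K s e)"] by blast
    have "hf (?K s) e < hf I e"
      using s(1) graded_ideal_eq_if_hf_le[OF I(1) K(1) K(3), of s] by force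
    then have fin: "finite {s'. colon (?K s) (curve s') e \<noteq> ?K s e}"
      by (intro less.hyps K)
    have eq: "?K s' e = ?K s e" if "?K s' e \<noteq> I e" "colon (?K s) (curve s') e = ?K s e" for s'
    proof (rule subspace_eq_if_dim_ge)
      \<comment> \<open>The colon by \<open>curve s'\<close> grows when \<open>I\<close> is replaced
        by \<open>?K s\<close>, where it equals \<open>?K s e\<close> by assumption; minimality of
        the dimension then forces equality.\<close>
      have "?K s' e \<subseteq> colon (?K s) (curve s') e"
        using graded_ideal_lin[OF I(1), of _ "Suc e" "\<lambda>i. s ^ i"] curve_mult_R[of _ e s']
        by (auto simp: colon_def curve_def)
      then show "?K s' e \<subseteq> ?K s e" using that(2) by simp
    qed (use K(1) s(2) that(1) in \<open>auto intro: graded_ideal_subspace graded_ideal_fin_dim\<close>)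
    obtain p where p: "p \<in> ?K s e" "p \<notin> I e" using s(1) K(3)[of s] by blast
    have "infinite ({s. ?K s e \<noteq> I e} - {s'. colon (?K s) (curve s') e \<noteq> ?K s e})"
      using inf fin by simp
    moreover have "{s. ?K s e \<noteq> I e} - {s'. colon (?K s) (curve s') e \<noteq> ?K s e} \<subseteq> {s. curve s * p \<in> I (Suc e)}"
    proof
      fix s' assume "s' \<in> {s. ?K s e \<noteq> I e} - {s'. colon (?K s) (curve s') e \<noteq> ?K s e}"
      then have "?K s' e = ?K s e" by (intro eq) auto
      then have "p \<in> ?K s' e" using p(1) by blast
      then show "s' \<in> {s. curve s * p \<in> I (Suc e)}" by (simp add: colon_def)
    qed
    ultimately have "infinite {s. curve s * p \<in> I (Suc e)}"
      by (rule infinite_super[rotated])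
    then have "\<forall>i\<le>n. x i * p \<in> I (Suc e)"
      using curve_annihilates[OF I(1)] by blast
    then show False
      using I(2) p by (auto simp: saturated_def colon_def)
  qed
qed

section \<open>Existence and openness of regular linear forms\<close>

lemma curve_regular_exists:
  assumes I: "graded_ideal I" "saturated I"
  obtains s where "\<And>e. e \<le> N \<Longrightarrow> colon I (curve s) e = I e"
proof -
  have "finite (\<Union>e\<le>N. {s. colon I (curve s) e \<noteq> I e})"
    using finite_curve_zero_divisors[OF I] by blast
  then obtain s where "s \<notin> (\<Union>e\<le>N. {s. colon I (curve s) e \<noteq> I e})"
    using ex_new_if_finite[OF infinite_field] by blast
  then show thesis using that by blast
qed

text \<open>Supplies a basis of \<open>W\<close> modulo \<open>U\<close> in the indexed form of
  \<open>independent_mod_open\<close>; \<open>U\<close> is enlarged by one vector at a time.\<close>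

lemma complement_exists:
  assumes "subspace U" "subspace W" "fin_dim W" "U \<subseteq> W"
  shows "\<exists>m b. (\<forall>i<m. b i \<in> W) \<and> (\<forall>p\<in>W. \<exists>c. p - (\<Sum>i<m::nat. scale (c i) (b i)) \<in> U) \<and>
    (\<forall>c. (\<Sum>i<m. scale (c i) (b i)) \<in> U \<longrightarrow> (\<forall>i<m. c i = 0))"
  using assms
proof (induction "dim W - dim U" arbitrary: U rule: less_induct)
  case less
  note U = less.prems
  show ?case
  proof (cases "U = W")
    case False
    then obtain v where v: "v \<in> W" "v \<notin> U" using U by blast
    define U' where "U' = span (insert v U)"
    have U': "subspace U'" "U' \<subseteq> W" "U \<subseteq> U'" "v \<in> U'"
      unfolding U'_def using U(2,4) v(1) by (simp_all add: span_minimal span_base subsetI)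
    have "dim U' = Suc (dim U)"
      unfolding U'_def using v U dim_insert_fin_dim[OF fin_dim_subset[OF U(3,4)]]
      by (simp add: span_eq_iff[THEN iffD2])
    moreover have "dim U' \<le> dim W" using U' U by (intro dim_mono_fin_dim)
    ultimately have "dim W - dim U' < dim W - dim U" by simp
    from less.hyps[OF this U'(1) U(2,3) U'(2)] obtain m :: nat and b where b: "\<forall>i<m. b i \<in> W"
      "\<forall>p\<in>W. \<exists>c. p - (\<Sum>i<m. scale (c i) (b i)) \<in> U'"
      "\<forall>c. (\<Sum>i<m. scale (c i) (b i)) \<in> U' \<longrightarrow> (\<forall>i<m. c i = 0)" by blast
    define b' where "b' = b(m := v)"
    have sum: "(\<Sum>i<Suc m. scale (c i) (b' i)) = (\<Sum>i<m. scale (c i) (b i)) + scale (c m) v" for c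
      by (simp add: b'_def)
    show ?thesis
    proof (intro exI[of _ "Suc m"] exI[of _ b'] conjI allI ballI impI)
      fix i assume "i < Suc m"
      then show "b' i \<in> W" using b(1) v by (auto simp: b'_def)
    next
      fix p assume "p \<in> W"
      then obtain c where "p - (\<Sum>i<m. scale (c i) (b i)) \<in> U'" using b(2) by blast
      then obtain k where "p - (\<Sum>i<m. scale (c i) (b i)) - scale k v \<in> U"
        unfolding U'_def span_breakdown_eq using U(1) by (auto simp: span_eq_iff[THEN iffD2])
      then have "p - (\<Sum>i<Suc m. scale ((c(m := k)) i) (b' i)) \<in> U"
        unfolding sum by (simp add: algebra_simps)
      then show "\<exists>c. p - (\<Sum>i<Suc m. scale (c i) (b' i)) \<in> U" by blast
    next
      fix c i assume c: "(\<Sum>i<Suc m. scale (c i) (b' i)) \<in> U" and i: "i < Suc m"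
      have "(\<Sum>i<m. scale (c i) (b i)) = (\<Sum>i<Suc m. scale (c i) (b' i)) - scale (c m) v"
        unfolding sum by simp
      also have "\<dots> \<in> U'"
        using c U' by (intro subspace_diff subspace_scale) auto
      finally have 0: "\<forall>i<m. c i = 0" using b(3) by blast
      then have "scale (c m) v \<in> U" using c unfolding sum by simp
      then have "c m = 0" using v U(1) by (metis scale_one scale_scale left_inverse subspace_scale)
      then show "c i = 0" using 0 i by (auto simp: less_Suc_eq)
    qed
  qed (use subspace_0[OF U(1)] in \<open>auto intro!: exI[of _ 0]\<close>)
qed

text \<open>Regularity in degree \<open>e\<close> means that the products of \<open>lin a\<close>
  with a basis of \<open>R e\<close> modulo \<open>I e\<close> are independent modulo
  \<open>I (Suc e)\<close>. Their coordinates are linear in \<open>a\<close>, so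
  \<open>independent_mod_open\<close> applies; \<open>P\<close> will consist of the polynomial
  functions.\<close>

lemma regular_open:
  fixes P :: "((nat \<Rightarrow> 'a) \<Rightarrow> 'a) set"
  assumes I: "graded_ideal I" and reg: "colon I (lin a\<^sub>0) e = I e"
    and one: "(\<lambda>_. 1) \<in> P" and mult: "\<And>f g. f \<in> P \<Longrightarrow> g \<in> P \<Longrightarrow> (\<lambda>t. f t * g t) \<in> P"
    and diff: "\<And>f g. f \<in> P \<Longrightarrow> g \<in> P \<Longrightarrow> (\<lambda>t. f t - g t) \<in> P"
    and linear: "\<And>k. (\<lambda>a. \<Sum>j\<le>n. a j * k j) \<in> P"
  shows "\<exists>F\<in>P. F a\<^sub>0 \<noteq> 0 \<and> (\<forall>a. F a \<noteq> 0 \<longrightarrow> colon I (lin a) e = I e)"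
proof -
  obtain m :: nat and b where b: "\<forall>i<m. b i \<in> R e"
    "\<forall>p\<in>R e. \<exists>c. p - (\<Sum>i<m. scale (c i) (b i)) \<in> I e"
    "\<forall>c. (\<Sum>i<m. scale (c i) (b i)) \<in> I e \<longrightarrow> (\<forall>i<m. c i = 0)"
    using complement_exists[OF graded_ideal_subspace[OF I] subspace_R fin_dim_R graded_ideal_subset[OF I]]
    by blast
  have sum: "(\<Sum>i<m. scale (c i) (lin a * b i)) = lin a * (\<Sum>i<m. scale (c i) (b i))" for a c
    by (simp add: sum_distrib_left mult_scale)
  have sumR: "(\<Sum>i<m. scale (c i) (b i)) \<in> R e" for c
    using b(1) by (intro subspace_sum subspace_scale subspace_R) auto
  have "\<exists>F\<in>P. F a\<^sub>0 \<noteq> 0 \<and> (\<forall>a. F a \<noteq> 0 \<longrightarrow>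
      (\<forall>c. (\<Sum>i<m. scale (c i) (lin a * b i)) \<in> I (Suc e) \<longrightarrow> (\<forall>i<m. c i = 0)))"
  proof (rule independent_mod_open[OF one mult diff graded_ideal_subspace[OF I]])
    fix i \<phi> assume "i < m" and \<phi>: "Vector_Spaces.linear scale (*) \<phi>"
    interpret \<phi>: Vector_Spaces.linear scale "(*) :: 'a \<Rightarrow> 'a \<Rightarrow> 'a" \<phi> by (rule \<phi>)
    show "(\<lambda>a. \<phi> (lin a * b i)) \<in> P"
      unfolding lin_mult \<phi>.sum \<phi>.scale by (rule linear)
  next
    fix c assume "(\<Sum>i<m. scale (c i) (lin a\<^sub>0 * b i)) \<in> I (Suc e)"
    then have "(\<Sum>i<m. scale (c i) (b i)) \<in> colon I (lin a\<^sub>0) e"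
      using sumR by (simp add: sum colon_def)
    then show "\<forall>i<m. c i = 0" using reg b(3) by simp
  qed
  then obtain F where F: "F \<in> P" "F a\<^sub>0 \<noteq> 0" "\<And>a c. F a \<noteq> 0 \<Longrightarrow>
      (\<Sum>i<m. scale (c i) (lin a * b i)) \<in> I (Suc e) \<Longrightarrow> \<forall>i<m. c i = 0" by blast
  have "colon I (lin a) e = I e" if a: "F a \<noteq> 0" for a
  proof
    show "colon I (lin a) e \<subseteq> I e"
    proof
      fix p assume p: "p \<in> colon I (lin a) e"
      then obtain c where c: "p - (\<Sum>i<m. scale (c i) (b i)) \<in> I e"
        using b(2) by (auto simp: colon_def)
      have "(\<Sum>i<m. scale (c i) (lin a * b i)) = lin a * p - lin a * (p - (\<Sum>i<m. scale (c i) (b i)))"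
        unfolding sum by (simp add: algebra_simps)
      also have "\<dots> \<in> I (Suc e)"
        using p graded_ideal_lin[OF I c] by (intro subspace_diff graded_ideal_subspace[OF I]) (auto simp: colon_def)
      finally have "\<forall>i<m. c i = 0" using F(3) a by blast
      then show "p \<in> I e" using c by simp
    qed
  qed (rule graded_ideal_subset_colon[OF I])
  then show ?thesis using F by blast
qed

section \<open>Hilbert functions of saturated ideals and of their hyperplane sections\<close>

theorem gotzmann_regularity:
  assumes I: "graded_ideal I" "saturated I" and pos: "\<And>d. hf I d > 0"
  obtains T where "T \<noteq> []" "\<And>d. d \<ge> length T \<Longrightarrow> tuple d T" "\<And>d. Suc d \<ge> length T \<Longrightarrow> hf I d = tval d T"
proof -
  obtain N where N: "\<And>d. d \<ge> N \<Longrightarrow> mac d (hf I d) = mac N (hf I N)" "N > 0"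
  proof (rule tuples_eventually_constant[of "\<lambda>d. mac d (hf I d)"])
    fix d :: nat assume "d > 0"
    then show "tdiff (Suc d) (mac (Suc d) (hf I (Suc d))) \<le> tval d (mac d (hf I d))"
      using macaulay[OF I(1)] by simp
  qed (simp, blast)
  define T where "T = mac N (hf I N)"
  have TN: "tuple N T" using N(2) by (simp add: T_def)
  have T: "tuple d T" if "d \<ge> length T" for d
    using TN that by (simp add: tuple_def)
  have lenN: "length T \<le> N" using TN by (simp add: tuple_def)
  have large: "hf I d = tval d T" if "d \<ge> N" for d
    using N(1)[OF that] N(2) that by (metis T_def less_le_trans tval_mac)
  \<comment> \<open>The descent from \<open>N\<close> reaches degree \<open>length T - 1\<close>,
    since \<open>macaulay_down\<close> asks for a tuple only in the degree it starts from.\<close>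
  have ge: "tval d T \<le> hf I d" if "d \<le> N" "Suc d \<ge> length T" for d
    using that
  proof (induction rule: inc_induct)
    case base
    then show ?case using large[of N] by simp
  next
    case (step d)
    show ?case by (rule macaulay_down[OF I(1) T]) (use step in auto)
  qed
  from curve_regular_exists[OF I] obtain s where s: "\<And>e. e \<le> N \<Longrightarrow> colon I (curve s) e = I e" by blast
  define J where "J = add_gen I (curve s)"
  have J: "graded_ideal J" unfolding J_def curve_def by (rule graded_ideal_add_gen[OF I(1)])
  have exact: "hf I (Suc e) = hf I e + hf J (Suc e)" if "e \<le> N" for e
  proof -
    have "hf (colon I (curve s)) e = hf I e" using s[OF that] by (simp add: hf_def)
    then show ?thesis using hf_exact[OF I(1), of e] unfolding J_def curve_def by metis
  qed
  \<comment> \<open>The expected Hilbert function of the section is \<open>tlow d T\<close>, with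
    difference set \<open>tdec T\<close>; it is a tuple from degree \<open>length T\<close> on, so
    the descent for \<open>J\<close> reaches that far.\<close>
  have T': "tlow d T = tval d (tdec T)" "tuple d (tdec T)" if "d \<ge> length T" for d
    using T[OF that] by (auto intro: tlow_eq_tval_tdec tuple_tdec)
  have split: "tval (Suc d) T = tlow (Suc d) T + tval d T" if "Suc d \<ge> length T" for d
    using that by (simp add: tval_eq[of T "Suc d"] tdiff_eq_tval)
  have Jge: "tval d (tdec T) \<le> hf J d" if "d \<le> Suc N" "d \<ge> length T" for d
    using that
  proof (induction rule: inc_induct)
    case base
    have "hf J (Suc N) = tlow (Suc N) T"
      using exact[of N] large[of N] large[of "Suc N"] split[of N] lenN by simp
    then show ?case using T'(1)[OF base] by simp
  next
    case (step d)
    show ?case by (rule macaulay_down[OF J T'(2)]) (use step in auto)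
  qed
  have le: "hf I d \<le> tval d T" if "d \<le> N" "Suc d \<ge> length T" for d
    using that
  proof (induction rule: inc_induct)
    case base
    then show ?case using large[of N] by simp
  next
    case (step d)
    have "hf I d + hf J (Suc d) = hf I (Suc d)" using exact[of d] step by simp
    also have "\<dots> \<le> tlow (Suc d) T + tval d T" using step split[of d] by simp
    also have "tlow (Suc d) T \<le> hf J (Suc d)" using Jge[of "Suc d"] T'(1)[of "Suc d"] step by simp
    finally show ?case by simp
  qed
  have "hf I d = tval d T" if "Suc d \<ge> length T" for d
    using large[of d] ge[of d] le[of d] that by (cases "d \<le> N") auto
  moreover have "T \<noteq> []" using large[of N] pos[of N] by auto
  ultimately show thesis using that T by blast
qed

text \<open>Asking for regularity in a single degree keeps the condition on \<open>a\<close> open;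
  Macaulay's bound carries the upper estimate to all higher degrees.\<close>

lemma hf_section:
  assumes I: "graded_ideal I" and T: "\<And>d. d \<ge> length T \<Longrightarrow> tuple d T" "T \<noteq> []"
    and hf: "\<And>d. Suc d \<ge> length T \<Longrightarrow> hf I d = tval d T"
    and reg: "colon I (lin a) (length T - 1) = I (length T - 1)" and d: "d \<ge> length T"
  shows "hf (add_gen I (lin a)) d = tlow d T"
proof -
  define J where "J = add_gen I (lin a)"
  have J: "graded_ideal J" unfolding J_def by (rule graded_ideal_add_gen[OF I])
  have T': "tlow d T = tval d (tdec T)" "tuple d (tdec T)" if "d \<ge> length T" for d
    using T(1)[OF that] by (auto intro: tlow_eq_tval_tdec tuple_tdec)
  have split: "tval (Suc d) T = tlow (Suc d) T + tval d T" if "Suc d \<ge> length T" for d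
    using that by (simp add: tval_eq[of T "Suc d"] tdiff_eq_tval)
  have exact: "hf I (Suc e) = hf (colon I (lin a)) e + hf J (Suc e)" for e
    unfolding J_def by (rule hf_exact[OF I])
  obtain r where r: "length T = Suc r" using T(2) by (cases T) auto
  have "hf (colon I (lin a)) r = hf I r" using reg r by (simp add: hf_def)
  then have base: "hf J (Suc r) = tlow (Suc r) T"
    using exact[of r] hf[of r] hf[of "Suc r"] split[of r] r by simp
  have "hf J d \<le> tval d (tdec T)"
    using d
  proof (induction rule: dec_induct)
    case base
    then show ?case using \<open>hf J (Suc r) = _\<close> T'(1)[of "Suc r"] r by simp
  next
    case (step d)
    show ?case by (rule macaulay_up[OF J T'(2)]) (use step in auto)
  qed
  moreover have "tlow d T \<le> hf J d"
  proof -
    obtain e where e: "d = Suc e" using d r by (cases d) auto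
    have "hf (colon I (lin a)) e \<le> hf I e"
      by (intro hf_antimono graded_ideal_colon I graded_ideal_subset_colon)
    then show ?thesis
      using exact[of e] hf[of e] hf[of d] split[of e] e d by simp
  qed
  ultimately show ?thesis using T'(1)[OF d] by (simp add: J_def)
qed

end

section \<open>Polynomials\<close>

lemma mdeg_add: "mdeg (a + b) = mdeg a + mdeg b"
  unfolding mdeg_def by (rule setsum_keys_plus_distrib) auto

lemma mdeg_single [simp]: "mdeg (Poly_Mapping.single i c) = c"
  by (simp add: mdeg_def)

lemma mdeg_0 [simp]: "mdeg 0 = 0"
  by (simp add: mdeg_def)

lemma mdeg_eq_0: "mdeg m = 0 \<longleftrightarrow> m = 0"
proof
  assume "mdeg m = 0"
  then show "m = 0"
    by (intro poly_mapping_eqI) (auto simp: mdeg_def in_keys_iff)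
qed simp

lemma keys_add_nat: "Poly_Mapping.keys (a + b :: nat \<Rightarrow>\<^sub>0 nat) = Poly_Mapping.keys a \<union> Poly_Mapping.keys b"
  by (auto simp: in_keys_iff lookup_add)

lemma sum_monomials: "(\<Sum>m\<in>Poly_Mapping.keys p. Poly_Mapping.single m (Poly_Mapping.lookup p m)) = p"
proof (rule poly_mapping_eqI)
  fix m
  have "Poly_Mapping.lookup (\<Sum>m\<in>Poly_Mapping.keys p. Poly_Mapping.single m (Poly_Mapping.lookup p m)) m
      = (\<Sum>m'\<in>Poly_Mapping.keys p. if m' = m then Poly_Mapping.lookup p m else 0)"
    unfolding lookup_sum by (rule sum.cong) (auto simp: lookup_single when_def)
  also have "\<dots> = Poly_Mapping.lookup p m"
    by (simp add: in_keys_iff)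
  finally show "Poly_Mapping.lookup (\<Sum>m\<in>Poly_Mapping.keys p. Poly_Mapping.single m (Poly_Mapping.lookup p m)) m
      = Poly_Mapping.lookup p m" .
qed

lemma mpolys_induct [consumes 1, case_names zero add single]:
  fixes p :: "'k::field mpoly"
  assumes "p \<in> mpolys V"
    and "P 0" "\<And>p q. p \<in> mpolys V \<Longrightarrow> q \<in> mpolys V \<Longrightarrow> P p \<Longrightarrow> P q \<Longrightarrow> P (p + q)"
    and "\<And>m c. Poly_Mapping.keys m \<subseteq> V \<Longrightarrow> P (Poly_Mapping.single m c)"
  shows "P p"
proof -
  have "P (\<Sum>m\<in>A. Poly_Mapping.single m (Poly_Mapping.lookup p m)) \<and>
      (\<Sum>m\<in>A. Poly_Mapping.single m (Poly_Mapping.lookup p m)) \<in> mpolys V"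
    if "finite A" "A \<subseteq> Poly_Mapping.keys p" for A
    using that
  proof (induction A)
    case empty
    then show ?case using assms(2) by (simp add: mpolys_def)
  next
    case (insert m A)
    then have m: "Poly_Mapping.keys m \<subseteq> V" using assms(1) by (auto simp: mpolys_def)
    then have s: "Poly_Mapping.single m c \<in> mpolys V" for c
      by (simp add: mpolys_def)
    have add: "p + q \<in> mpolys V" if "p \<in> mpolys V" "q \<in> mpolys V" for p q :: "'k mpoly"
      using that Poly_Mapping.keys_add[of p q] by (auto simp: mpolys_def)
    from insert have IH: "P (\<Sum>m\<in>A. Poly_Mapping.single m (Poly_Mapping.lookup p m))"
      "(\<Sum>m\<in>A. Poly_Mapping.single m (Poly_Mapping.lookup p m)) \<in> mpolys V" by simp_all
    show ?case
      unfolding sum.insert[OF insert.hyps]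
      using add[OF s IH(2)] assms(3)[OF s IH(2) assms(4)[OF m] IH(1)] by blast
  qed
  from this[of "Poly_Mapping.keys p"] show ?thesis by (simp add: sum_monomials)
qed

lemma mpolys_UNIV: "p \<in> mpolys UNIV"
  by (simp add: mpolys_def)

lemma
  shows mpolys_0 [simp]: "0 \<in> mpolys V"
    and mpolys_1 [simp]: "1 \<in> mpolys V"
    and mpolys_const [simp]: "const c \<in> mpolys V"
    and mpolys_var: "i \<in> V \<Longrightarrow> var i \<in> mpolys V"
    and mpolys_uminus: "p \<in> mpolys V \<Longrightarrow> - p \<in> mpolys V"
    and mpolys_add: "p \<in> mpolys V \<Longrightarrow> q \<in> mpolys V \<Longrightarrow> p + q \<in> mpolys V"
  using Poly_Mapping.keys_add[of p q]
  by (auto simp: mpolys_def const_def var_def in_keys_iff split: if_splits)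

lemma mpolys_mult: "p \<in> mpolys V \<Longrightarrow> q \<in> mpolys V \<Longrightarrow> p * q \<in> mpolys V"
  using keys_mult[of p q] by (fastforce simp: mpolys_def keys_add_nat)

lemma mpolys_diff: "p \<in> mpolys V \<Longrightarrow> q \<in> mpolys V \<Longrightarrow> p - q \<in> mpolys V"
  using mpolys_add[of p V "- q"] mpolys_uminus[of q V] by simp

section \<open>The polynomial ring and its field of constants\<close>

lemma cring_poly_ring: "cring (poly_ring V :: 'k::field mpoly ring)"
proof (rule cringI)
  show "abelian_group (poly_ring V :: 'k mpoly ring)"
  proof (rule abelian_groupI)
    fix p :: "'k mpoly" assume "p \<in> carrier (poly_ring V)"
    then show "\<exists>q\<in>carrier (poly_ring V). q \<oplus>\<^bsub>poly_ring V\<^esub> p = \<zero>\<^bsub>poly_ring V\<^esub>"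
      by (intro bexI[of _ "- p"]) (auto simp: poly_ring_def mpolys_uminus)
  qed (auto simp: poly_ring_def mpolys_add add.assoc add.commute)
  show "comm_monoid (poly_ring V :: 'k mpoly ring)"
    by (rule comm_monoidI) (auto simp: poly_ring_def mpolys_mult mult.assoc mult.commute)
qed (auto simp: poly_ring_def distrib_right)

lemma poly_ring_simps [simp]:
  "carrier (poly_ring V) = mpolys V" "p \<oplus>\<^bsub>poly_ring V\<^esub> q = p + q" "p \<otimes>\<^bsub>poly_ring V\<^esub> q = p * q"
  "\<zero>\<^bsub>poly_ring V\<^esub> = 0" "\<one>\<^bsub>poly_ring V\<^esub> = 1"
  by (simp_all add: poly_ring_def)

lemma const_0: "const 0 = 0" and const_1: "const 1 = 1"
  and const_add: "const (c + d) = const c + const d" and const_mult: "const (c * d) = const c * const d"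
  and const_diff: "const (c - d) = const c - const d"
  by (simp_all add: const_def single_add mult_single single_diff)

lemma const_minus_1: "const (- 1) = - 1"
  using const_diff[of 0 1] by (simp add: const_0 const_1)

lemma subfield_const: "subfield (range const) (poly_ring V :: 'k::field mpoly ring)"
proof -
  interpret cring "poly_ring V :: 'k mpoly ring" by (rule cring_poly_ring)
  let ?K = "(poly_ring V :: 'k mpoly ring) \<lparr>carrier := range const\<rparr>"
  have [simp]: "carrier ?K = range const" "p \<oplus>\<^bsub>?K\<^esub> q = p + q" "p \<otimes>\<^bsub>?K\<^esub> q = p * q"
    "\<zero>\<^bsub>?K\<^esub> = 0" "\<one>\<^bsub>?K\<^esub> = 1" for p q
    by (simp_all add: poly_ring_def)
  have 01: "0 \<in> range (const :: 'k \<Rightarrow> _)" "1 \<in> range (const :: 'k \<Rightarrow> _)"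
    by (metis const_0 rangeI, metis const_1 rangeI)
  have "cring ?K"
  proof (rule cringI)
    show "abelian_group ?K"
    proof (rule abelian_groupI)
      fix p assume "p \<in> carrier ?K"
      then obtain c where "p = const c" by auto
      then show "\<exists>q\<in>carrier ?K. q \<oplus>\<^bsub>?K\<^esub> p = \<zero>\<^bsub>?K\<^esub>"
        by (intro bexI[of _ "const (- c)"]) (auto simp flip: const_add simp: const_0)
    qed (use 01 in \<open>auto simp: add.assoc add.commute simp flip: const_add\<close>)
    show "comm_monoid ?K"
      by (rule comm_monoidI) (use 01 in \<open>auto simp: mult.assoc mult.commute simp flip: const_mult\<close>)
  qed (auto simp: distrib_right)
  then have "field ?K"
  proof (rule cring.cring_fieldI2)
    show "\<zero>\<^bsub>?K\<^esub> \<noteq> \<one>\<^bsub>?K\<^esub>" by simp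
    fix p assume "p \<in> carrier ?K" "p \<noteq> \<zero>\<^bsub>?K\<^esub>"
    then obtain c where c: "p = const c" "c \<noteq> 0" using const_0 by auto
    then show "\<exists>q\<in>carrier ?K. p \<otimes>\<^bsub>?K\<^esub> q = \<one>\<^bsub>?K\<^esub>"
      by (intro bexI[of _ "const (inverse c)"]) (auto simp flip: const_mult simp: const_1)
  qed
  then show ?thesis by (rule subfield_iff) auto
qed


section \<open>Homogeneous components and dehomogenization\<close>

lemma lookup_hom_component:
  "Poly_Mapping.lookup (hom_component d p) m = (if mdeg m = d then Poly_Mapping.lookup p m else 0)"
proof -
  have "Poly_Mapping.lookup (hom_component d p) m =
      (\<Sum>m'\<in>{m \<in> Poly_Mapping.keys p. mdeg m = d}. if m' = m then Poly_Mapping.lookup p m else 0)"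
    unfolding hom_component_def lookup_sum by (rule sum.cong) (auto simp: lookup_single when_def)
  also have "\<dots> = (if mdeg m = d then Poly_Mapping.lookup p m else 0)"
    by (auto simp: in_keys_iff)
  finally show ?thesis .
qed

lemma hom_component_add: "hom_component d (p + q) = hom_component d p + hom_component d q"
  by (intro poly_mapping_eqI) (simp add: lookup_hom_component lookup_add)

lemma hom_component_diff: "hom_component d (p - q) = hom_component d p - hom_component d q"
  by (intro poly_mapping_eqI) (simp add: lookup_hom_component lookup_minus)

lemma hom_component_0 [simp]: "hom_component d 0 = 0"
  by (intro poly_mapping_eqI) (simp add: lookup_hom_component)

lemma hom_component_single:
  "hom_component d (Poly_Mapping.single m c) = (if mdeg m = d then Poly_Mapping.single m c else 0)"
  by (intro poly_mapping_eqI) (auto simp: lookup_hom_component lookup_single when_def)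

lemma hom_component_forms: "p \<in> forms V e \<Longrightarrow> hom_component d p = (if d = e then p else 0)"
  by (intro poly_mapping_eqI) (auto simp: lookup_hom_component forms_def in_keys_iff)

lemma hom_component_in_forms: "p \<in> mpolys V \<Longrightarrow> hom_component d p \<in> forms V d"
  by (auto simp: forms_def mpolys_def in_keys_iff lookup_hom_component split: if_splits)

lemma hom_component_single_mult:
  "hom_component d (Poly_Mapping.single m c * p) =
     (if mdeg m \<le> d then Poly_Mapping.single m c * hom_component (d - mdeg m) p else 0)"
proof (induction rule: mpolys_induct[OF mpolys_UNIV[of p]])
  case (2 p q)
  then show ?case by (simp add: distrib_left hom_component_add)
next
  case (3 m' c')
  show ?case by (auto simp: mult_single hom_component_single mdeg_add)
qed simp

text \<open>Serves to replace an arbitrary multiplier of a form by one of its homogeneous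
  components.\<close>

lemma hom_component_mult_form:
  assumes h: "h \<in> forms V k"
  shows "hom_component (d + k) (g * h) = hom_component d g * h"
    and "d < k \<Longrightarrow> hom_component d (g * h) = 0"
proof -
  show "hom_component (d + k) (g * h) = hom_component d g * h"
  proof (induction rule: mpolys_induct[OF mpolys_UNIV[of g]])
    case (2 p q)
    then show ?case by (simp add: distrib_right hom_component_add)
  next
    case (3 m c)
    show ?case
      by (auto simp: hom_component_single_mult hom_component_single hom_component_forms[OF h])
  qed simp
  show "hom_component d (g * h) = 0" if "d < k"
  proof (induction rule: mpolys_induct[OF mpolys_UNIV[of g]])
    case (2 p q)
    then show ?case by (simp add: distrib_right hom_component_add)
  next
    case (3 m c)
    show ?case
      using that by (auto simp: hom_component_single_mult hom_component_single hom_component_forms[OF h])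
  qed simp
qed

lemma dehom_add: "dehom i (p + q) = dehom i p + dehom i q"
  unfolding dehom_def by (rule setsum_keys_plus_distrib) (auto simp: single_add)

lemma dehom_0 [simp]: "dehom i 0 = 0"
  by (simp add: dehom_def)

lemma dehom_single: "dehom i (Poly_Mapping.single m c) = Poly_Mapping.single (Poly_Mapping.update i 0 m) c"
  by (simp add: dehom_def)

lemma update_0_add: "Poly_Mapping.update i 0 (a + b :: nat \<Rightarrow>\<^sub>0 nat) = Poly_Mapping.update i 0 a + Poly_Mapping.update i 0 b"
  by (intro poly_mapping_eqI) (simp add: lookup_update lookup_add)

lemma dehom_mult: "dehom i (p * q) = dehom i p * dehom i q"
proof (induction rule: mpolys_induct[OF mpolys_UNIV[of p]])
  case (2 p p')
  then show ?case by (simp add: distrib_right dehom_add)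
next
  case (3 m c)
  show ?case
  proof (induction rule: mpolys_induct[OF mpolys_UNIV[of q]])
    case (2 q q')
    then show ?case by (simp add: distrib_left dehom_add)
  next
    case (3 m' c')
    show ?case by (simp add: mult_single dehom_single update_0_add)
  qed simp
qed simp

lemma dehom_const [simp]: "dehom i (const c) = const c"
proof -
  have "Poly_Mapping.update i 0 (0 :: nat \<Rightarrow>\<^sub>0 nat) = 0"
    by (intro poly_mapping_eqI) (simp add: lookup_update)
  then show ?thesis by (simp add: const_def dehom_single)
qed

lemma dehom_var_self [simp]: "dehom i (var i) = 1"
proof -
  have "Poly_Mapping.update i 0 (Poly_Mapping.single i 1 :: nat \<Rightarrow>\<^sub>0 nat) = 0"
    by (intro poly_mapping_eqI) (simp add: lookup_update lookup_single when_def)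
  then show ?thesis by (simp add: var_def dehom_single)
qed

lemma dehom_in_mpolys: 
  assumes "p \<in> mpolys V"
  shows "dehom i p \<in> mpolys (V - {i})"
  using assms
proof (induction rule: mpolys_induct)
  case (add p q)
  then show ?case by (simp add: dehom_add mpolys_add)
next
  case (single m c)
  then show ?case by (auto simp: dehom_single mpolys_def keys_update)
qed simp


section \<open>The graded algebra of polynomials\<close>

definition mscale :: "'k::field \<Rightarrow> 'k mpoly \<Rightarrow> 'k mpoly" where
  "mscale c p = const c * p"

lemma linear_space_mscale: "linear_space (mscale :: 'k::field \<Rightarrow> _)"
  by unfold_locales
    (simp_all add: mscale_def const_add const_mult const_1 distrib_left distrib_right mult.assoc)

lemma keys_mscale: "Poly_Mapping.keys (mscale c p) \<subseteq> Poly_Mapping.keys p"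
  using keys_mult[of "const c" p] by (auto simp: mscale_def const_def split: if_splits)

lemma
  shows forms_0 [simp]: "0 \<in> forms V d"
    and forms_add: "p \<in> forms V d \<Longrightarrow> q \<in> forms V d \<Longrightarrow> p + q \<in> forms V d"
    and forms_mscale: "p \<in> forms V d \<Longrightarrow> mscale c p \<in> forms V d"
  using Poly_Mapping.keys_add[of p q] keys_mscale[of c p]
  by (force simp: forms_def mpolys_def)+

lemma forms_mult: "p \<in> forms V d \<Longrightarrow> q \<in> forms V e \<Longrightarrow> p * q \<in> forms V (d + e)"
  using keys_mult[of p q] mpolys_mult[of p V q] by (fastforce simp: forms_def mdeg_add)

lemma var_in_forms: "i \<in> V \<Longrightarrow> var i \<in> forms V 1"
  by (auto simp: forms_def mpolys_var) (auto simp: var_def)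

lemma forms_subset_mpolys: "forms V d \<subseteq> mpolys V"
  by (auto simp: forms_def)

lemma forms_0_const:
  assumes "p \<in> forms V 0"
  shows "p = const (Poly_Mapping.lookup p 0)"
proof (rule poly_mapping_eqI)
  fix m
  show "Poly_Mapping.lookup p m = Poly_Mapping.lookup (const (Poly_Mapping.lookup p 0)) m"
    using assms by (cases "m = 0") (auto simp: const_def lookup_single when_def forms_def mdeg_eq_0 in_keys_iff)
qed

text \<open>Generation in degree one comes from dividing each monomial by a variable occurring in
  it; characteristic zero makes the field infinite.\<close>

lemma graded_algebra_forms:
  "graded_algebra mscale (forms {..n}) (var :: nat \<Rightarrow> 'k::field_char_0 mpoly) n"
proof -
  interpret linear_space "mscale :: 'k \<Rightarrow> _" by (rule linear_space_mscale)
  have sub: "subspace (forms {..n} d)" for d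
    unfolding subspace_def using forms_add forms_mscale by auto
  show ?thesis
  proof unfold_locales
    have "p \<in> span {1}" if "p \<in> forms {..n} 0" for p :: "'k mpoly"
    proof -
      have "p = mscale (Poly_Mapping.lookup p 0) 1"
        using forms_0_const[OF that] by (simp add: mscale_def)
      also have "\<dots> \<in> span {1}" by (intro span_scale span_base) simp
      finally show ?thesis .
    qed
    then show "fin_dim (forms {..n} 0)"
      unfolding fin_dim_def by (intro exI[of _ "{1}"]) auto
    fix d
    show "var i * p \<in> forms {..n} (Suc d)" if "i \<le> n" "p \<in> forms {..n} d" for i and p :: "'k mpoly"
      using forms_mult[OF var_in_forms that(2), of i] that(1) by simp
    show "forms {..n} (Suc d) \<subseteq> span {var i * p | i p. i \<le> n \<and> p \<in> forms {..n} d}"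
    proof
      fix p :: "'k mpoly" assume p: "p \<in> forms {..n} (Suc d)"
      have "Poly_Mapping.single m (Poly_Mapping.lookup p m) \<in> span {var i * p | i p. i \<le> n \<and> p \<in> forms {..n} d}"
        if m: "m \<in> Poly_Mapping.keys p" for m
      proof -
        have deg: "mdeg m = Suc d" and mn: "Poly_Mapping.keys m \<subseteq> {..n}"
          using p m by (auto simp: forms_def mpolys_def)
        then have "Poly_Mapping.keys m \<noteq> {}" by (auto simp: mdeg_def)
        then obtain i where i: "i \<in> Poly_Mapping.keys m" by blast
        define m' where "m' = m - Poly_Mapping.single i 1"
        have m': "m = Poly_Mapping.single i 1 + m'"
          using i unfolding m'_def
          by (intro poly_mapping_eqI) (auto simp: lookup_add lookup_minus lookup_single when_def in_keys_iff)
        then have "mdeg m' = d" "Poly_Mapping.keys m' \<subseteq> {..n}"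
          using deg mn mdeg_add[of "Poly_Mapping.single i 1" m'] by (auto simp: keys_add_nat)
        then have "Poly_Mapping.single m' (Poly_Mapping.lookup p m) \<in> forms {..n} d"
          by (auto simp: forms_def mpolys_def)
        moreover have "Poly_Mapping.single m (Poly_Mapping.lookup p m) =
            var i * Poly_Mapping.single m' (Poly_Mapping.lookup p m)"
          by (simp only: var_def mult_single mult_1 m'[symmetric])
        ultimately show ?thesis using i mn by (intro span_base) auto
      qed
      then have "(\<Sum>m\<in>Poly_Mapping.keys p. Poly_Mapping.single m (Poly_Mapping.lookup p m))
          \<in> span {var i * p | i p. i \<le> n \<and> p \<in> forms {..n} d}"
        by (rule span_sum)
      then show "p \<in> span {var i * p | i p. i \<le> n \<and> p \<in> forms {..n} d}"
        by (simp add: sum_monomials)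
    qed
  qed (use sub in \<open>auto simp: mscale_def mult.assoc infinite_UNIV_char_0\<close>)
qed


section \<open>Dimensions of graded pieces of quotient rings\<close>

text \<open>The two notions of dimension are matched by starting from \<open>I d\<close>, whose
  image is zero, and adding one form at a time: a form outside the span yields a line extension of
  the image. The condition that 1 is not in \<open>J\<close> makes the image of the constants a
  subfield.\<close>

lemma ring_dim_image:
  fixes Q :: "'q ring" and \<phi> :: "'k::field_char_0 mpoly \<Rightarrow> 'q"
  assumes hom: "ring_hom_ring (poly_ring {..n}) Q \<phi>"
    and ker: "\<And>p. p \<in> mpolys {..n} \<Longrightarrow> \<phi> p = \<zero>\<^bsub>Q\<^esub> \<longleftrightarrow> p \<in> J"
    and one: "1 \<notin> J" and I: "graded_algebra.graded_ideal mscale (forms {..n}) var n I"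
    and IJ: "\<And>d. I d = J \<inter> forms {..n} d"
  shows "ring.dim Q (\<phi> ` range const) (\<phi> ` forms {..n} d) = graded_algebra.hf mscale (forms {..n}) I d"
proof -
  interpret A: graded_algebra mscale "forms {..n}" "var :: nat \<Rightarrow> 'k mpoly" n
    by (rule graded_algebra_forms)
  interpret \<phi>: ring_hom_ring "poly_ring {..n} :: 'k mpoly ring" Q \<phi> by (rule hom)
  have add: "\<phi> (p + q) = \<phi> p \<oplus>\<^bsub>Q\<^esub> \<phi> q" and mult: "\<phi> (p * q) = \<phi> p \<otimes>\<^bsub>Q\<^esub> \<phi> q"
    and closed: "\<phi> p \<in> carrier Q"
    if "p \<in> mpolys {..n}" "q \<in> mpolys {..n}" for p q
    using that \<phi>.hom_add[of p q] \<phi>.hom_mult[of p q] \<phi>.hom_closed[of p] by simp_all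
  have eq: "p - q \<in> J" if "p \<in> mpolys {..n}" "q \<in> mpolys {..n}" "\<phi> p = \<phi> q" for p q
  proof -
    have "\<phi> (p - q) \<oplus>\<^bsub>Q\<^esub> \<phi> q = \<zero>\<^bsub>Q\<^esub> \<oplus>\<^bsub>Q\<^esub> \<phi> q"
      using add[of "p - q" q] that closed[of q q] by (simp add: mpolys_diff)
    then have "\<phi> (p - q) = \<zero>\<^bsub>Q\<^esub>"
      using that closed[of q q] closed[of "p - q" q] mpolys_diff[of p "{..n}" q]
      by (metis \<phi>.S.add.right_cancel \<phi>.S.zero_closed)
    then show ?thesis using ker[of "p - q"] that by (simp add: mpolys_diff)
  qed
  have "\<one>\<^bsub>Q\<^esub> \<noteq> \<zero>\<^bsub>Q\<^esub>"
    using ker[of 1] one \<phi>.hom_one by simp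
  then have K: "subfield (\<phi> ` range const) Q"
    using \<phi>.img_is_subfield(2)[OF subfield_const] by blast
  have sub: "A.subspace (I d)" and IR: "I d \<subseteq> forms {..n} d" and fd: "A.fin_dim (I d)"
    by (intro A.graded_ideal_subspace A.graded_ideal_subset A.graded_ideal_fin_dim I)+
  have step: "\<phi>.S.dimension (A.dim (I d \<union> C) - A.dim (I d)) (\<phi> ` range const) (\<phi> ` A.span (I d \<union> C))"
    if "finite C" "C \<subseteq> forms {..n} d" for C
    using that
  proof (induction C)
    case empty
    have "\<phi> ` I d = {\<zero>\<^bsub>Q\<^esub>}"
      using A.subspace_0[OF sub] ker IJ[of d] forms_subset_mpolys[of "{..n}" d] by force
    then show ?case
      using sub \<phi>.S.dimension.zero_dim by (simp add: A.span_eq_iff[THEN iffD2])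
  next
    case (insert v C)
    have v: "v \<in> forms {..n} d" and C: "C \<subseteq> forms {..n} d" using insert.prems by auto
    have fdC: "A.fin_dim (I d \<union> C)"
      using insert.hyps(1) by (intro A.fin_dim_Un fd A.fin_dim_finite)
    have spR: "A.span (I d \<union> C) \<subseteq> forms {..n} d"
      using C IR by (intro A.span_minimal A.subspace_R) auto
    have mono: "A.dim (I d) \<le> A.dim (I d \<union> C)"
      by (intro A.dim_mono_fin_dim fdC) auto
    show ?case
    proof (cases "v \<in> A.span (I d \<union> C)")
      case True
      then show ?thesis
        using insert A.span_redundant[OF True] A.dim_insert_fin_dim[OF fdC, of v] by simp
    next
      case False
      have notin: "\<phi> v \<notin> \<phi> ` A.span (I d \<union> C)"
      proof
        assume "\<phi> v \<in> \<phi> ` A.span (I d \<union> C)"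
        then obtain u where u: "u \<in> A.span (I d \<union> C)" "\<phi> v = \<phi> u" by blast
        then have "u \<in> forms {..n} d" using spR by blast
        then have "v - u \<in> I d"
          using eq[of v u] u(2) v forms_subset_mpolys IJ[of d] A.subspace_diff[OF A.subspace_R v] by blast
        then have "v - u + u \<in> A.span (I d \<union> C)"
          using u(1) by (intro A.span_add) (auto intro: A.span_base)
        then show False using False by simp
      qed
      have "\<phi>.S.line_extension (\<phi> ` range const) (\<phi> v) (\<phi> ` A.span (I d \<union> C)) = \<phi> ` A.span (insert v (I d \<union> C))"
      proof -
        have lin: "\<phi> (const c) \<otimes>\<^bsub>Q\<^esub> \<phi> v \<oplus>\<^bsub>Q\<^esub> \<phi> u = \<phi> (u + mscale c v)"
          if "u \<in> A.span (I d \<union> C)" for c u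
          using that spR v forms_subset_mpolys[of "{..n}" d] mult[of "const c" v] add[of "mscale c v" u]
          by (auto simp: mscale_def mpolys_mult add.commute subset_iff)
        have "\<phi> ` A.span (insert v (I d \<union> C)) = {\<phi> (u + mscale c v) | u c. u \<in> A.span (I d \<union> C)}"
        proof -
          have "A.span (insert v (I d \<union> C)) = {u + mscale c v | u c. u \<in> A.span (I d \<union> C)}"
            unfolding A.span_insert by (auto simp: algebra_simps) (metis add_diff_cancel_left' diff_add_cancel)+
          then show ?thesis by auto
        qed
        then show ?thesis
          using lin by (auto simp: \<phi>.S.line_extension_mem_iff) (metis, metis)
      qed
      then show ?thesis
        using \<phi>.S.dimension.Suc_dim[OF closed notin insert.IH[OF C]] v forms_subset_mpolys[of "{..n}" d] False
          A.dim_insert_fin_dim[OF fdC, of v] mono by (auto simp: Suc_diff_le)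
    qed
  qed
  obtain C where C: "finite C" "C \<subseteq> forms {..n} d" "forms {..n} d \<subseteq> A.span C"
    using A.fin_dim_basis[OF A.fin_dim_R] by metis
  have "A.span (I d \<union> C) = forms {..n} d"
  proof (rule A.span_subspace)
    show "forms {..n} d \<subseteq> A.span (I d \<union> C)"
      by (rule order_trans[OF C(3)]) (intro A.span_mono, auto)
  qed (use C(2) IR A.subspace_R in auto)
  then have "\<phi>.S.dimension (A.hf I d) (\<phi> ` range const) (\<phi> ` forms {..n} d)"
    using step[OF C(1,2)] A.dim_span[of "I d \<union> C"] by (simp add: A.hf_def)
  then show ?thesis
    using \<phi>.S.dimI[OF K] by (simp add: over_def)
qed

lemma ker_rcos:
  assumes "ideal I R" "p \<in> carrier R"
  shows "I +>\<^bsub>R\<^esub> p = \<zero>\<^bsub>R Quot I\<^esub> \<longleftrightarrow> p \<in> I"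
proof -
  interpret ideal I R by (rule assms)
  show ?thesis
    using a_rcos_const[of p] a_rcos_self[OF assms(2)] by (auto simp: FactRing_def)
qed

section \<open>The homogeneous coordinate ring\<close>

definition graded_saturated_ideal ::
    "nat \<Rightarrow> (nat \<Rightarrow> 'k::field mpoly set) \<Rightarrow> nat \<Rightarrow> 'k mpoly set" where
  "graded_saturated_ideal n X d = saturated_ideal n X \<inter> forms {..n} d"

lemma
  assumes "closed_subscheme n X" "i \<le> n"
  shows chart_ideal: "ideal (X i) (poly_ring ({..n} - {i}))"
    and chart_0: "0 \<in> X i"
    and chart_add: "p \<in> X i \<Longrightarrow> q \<in> X i \<Longrightarrow> p + q \<in> X i"
    and chart_mult: "p \<in> X i \<Longrightarrow> q \<in> mpolys ({..n} - {i}) \<Longrightarrow> q * p \<in> X i"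
proof -
  show *: "ideal (X i) (poly_ring ({..n} - {i}))"
    using assms by (simp add: closed_subscheme_def)
  interpret ideal "X i" "poly_ring ({..n} - {i})" by (rule *)
  show "0 \<in> X i" using additive_subgroup.zero_closed[OF additive_subgroup_axioms] by simp
  show "p + q \<in> X i" if "p \<in> X i" "q \<in> X i"
    using additive_subgroup.a_closed[OF additive_subgroup_axioms that] by simp
  show "q * p \<in> X i" if "p \<in> X i" "q \<in> mpolys ({..n} - {i})" using I_l_closed that by simp
qed

lemma saturated_ideal_forms:
  assumes "closed_subscheme n X" "p \<in> forms {..n} d"
  shows "p \<in> saturated_ideal n X \<longleftrightarrow> (\<forall>i\<le>n. dehom i p \<in> X i)"
  using assms(2) chart_0[OF assms(1)]
  by (auto simp: saturated_ideal_def hom_component_forms[OF assms(2)] forms_def)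

lemma hom_component_saturated_ideal:
  assumes "closed_subscheme n X" "p \<in> saturated_ideal n X"
  shows "hom_component d p \<in> graded_saturated_ideal n X d"
proof -
  have "hom_component d p \<in> forms {..n} d"
    using assms(2) by (auto simp: saturated_ideal_def intro: hom_component_in_forms)
  then show ?thesis
    using assms(2) saturated_ideal_forms[OF assms(1)]
    by (auto simp: graded_saturated_ideal_def saturated_ideal_def)
qed

lemma saturated_ideal_add:
  assumes "closed_subscheme n X" "p \<in> saturated_ideal n X" "q \<in> saturated_ideal n X"
  shows "p + q \<in> saturated_ideal n X"
  using assms(2,3) chart_add[OF assms(1)]
  by (auto simp: saturated_ideal_def hom_component_add dehom_add mpolys_add)

lemma saturated_ideal_mult:
  assumes X: "closed_subscheme n X" and p: "p \<in> saturated_ideal n X" and q: "q \<in> mpolys {..n}"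
  shows "q * p \<in> saturated_ideal n X"
  using q
proof (induction rule: mpolys_induct)
  case zero
  show ?case using chart_0[OF X] by (simp add: saturated_ideal_def)
next
  case (add q q')
  then show ?case by (simp add: distrib_right saturated_ideal_add[OF X])
next
  case (single m c)
  then have m: "Poly_Mapping.single m c \<in> mpolys {..n}" by (simp add: mpolys_def)
  have "dehom i (hom_component d (Poly_Mapping.single m c * p)) \<in> X i" if "i \<le> n" for d i
    using p that chart_0[OF X that] chart_mult[OF X that _ dehom_in_mpolys[OF m, of i]]
    by (auto simp: saturated_ideal_def hom_component_single_mult dehom_mult)
  then show ?case
    using m p by (auto simp: saturated_ideal_def intro: mpolys_mult)
qed

lemma ideal_saturated_ideal:
  assumes X: "closed_subscheme n X"
  shows "ideal (saturated_ideal n X) (poly_ring {..n})"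
proof -
  interpret cring "poly_ring {..n} :: 'a mpoly ring" by (rule cring_poly_ring)
  have sub: "saturated_ideal n X \<subseteq> mpolys {..n}" by (auto simp: saturated_ideal_def)
  have zero: "0 \<in> saturated_ideal n X"
    using chart_0[OF X] by (simp add: saturated_ideal_def)
  have uminus: "- p \<in> saturated_ideal n X" if "p \<in> saturated_ideal n X" for p
    using saturated_ideal_mult[OF X that mpolys_const[of "- 1"]] by (simp add: const_minus_1)
  have inv: "\<ominus>\<^bsub>poly_ring {..n}\<^esub> p = - p" if "p \<in> mpolys {..n}" for p :: "'a mpoly"
    using minus_equality[of "- p" p] that by (simp add: mpolys_uminus)
  show ?thesis
  proof (rule idealI[OF ring_axioms])
    show "subgroup (saturated_ideal n X) (add_monoid (poly_ring {..n}))"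
    proof (rule add.subgroupI)
      fix p assume "p \<in> saturated_ideal n X"
      then show "\<ominus>\<^bsub>poly_ring {..n}\<^esub> p \<in> saturated_ideal n X"
        using inv sub uminus by auto
    qed (use sub zero saturated_ideal_add[OF X] in auto)
  qed (use saturated_ideal_mult[OF X] in \<open>auto simp: mult.commute\<close>)
qed

text \<open>Saturation holds because x_i becomes 1 on chart \<open>i\<close>, so that p and x_i p
  impose the same condition there.\<close>

lemma graded_saturated_ideal:
  fixes X :: "nat \<Rightarrow> 'k::field_char_0 mpoly set"
  assumes X: "closed_subscheme n X"
  shows "graded_algebra.graded_ideal mscale (forms {..n}) var n (graded_saturated_ideal n X)"
    and "graded_algebra.saturated (forms {..n}) var n (graded_saturated_ideal n X)"
proof -
  interpret A: graded_algebra mscale "forms {..n}" "var :: nat \<Rightarrow> 'k mpoly" n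
    by (rule graded_algebra_forms)
  interpret I: ideal "saturated_ideal n X" "poly_ring {..n}" by (rule ideal_saturated_ideal[OF X])
  show "A.graded_ideal (graded_saturated_ideal n X)"
    unfolding A.graded_ideal_def A.subspace_def graded_saturated_ideal_def
    using additive_subgroup.zero_closed[OF I.additive_subgroup_axioms] saturated_ideal_add[OF X] saturated_ideal_mult[OF X] forms_add forms_mscale A.x_mult_R
    by (auto simp: mscale_def mpolys_var)
  show "A.saturated (graded_saturated_ideal n X)"
    unfolding A.saturated_def
  proof (intro allI ballI impI)
    fix d p
    assume p: "p \<in> forms {..n} d" and sat: "\<forall>i\<le>n. var i * p \<in> graded_saturated_ideal n X (Suc d)"
    have "dehom i p \<in> X i" if "i \<le> n" for i
    proof -
      have "dehom i (var i * p) \<in> X i"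
        using sat that saturated_ideal_forms[OF X A.x_mult_R[OF that p]]
        by (auto simp: graded_saturated_ideal_def)
      then show ?thesis by (simp add: dehom_mult)
    qed
    then show "p \<in> graded_saturated_ideal n X d"
      using p saturated_ideal_forms[OF X p] by (simp add: graded_saturated_ideal_def)
  qed
qed

text \<open>On a chart that meets \<open>X\<close>, the form x_i^d dehomogenizes to 1, which a
  proper ideal does not contain.\<close>

lemma graded_saturated_ideal_proper:
  fixes X :: "nat \<Rightarrow> 'k::field_char_0 mpoly set"
  assumes X: "closed_subscheme n X" and ne: "nonempty_subscheme n X"
  shows "graded_saturated_ideal n X d \<noteq> forms {..n} d"
proof
  assume eq: "graded_saturated_ideal n X d = forms {..n} d"
  from ne obtain i where i: "i \<le> n" "X i \<noteq> mpolys ({..n} - {i})"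
    by (auto simp: nonempty_subscheme_def)
  interpret I: ideal "X i" "poly_ring ({..n} - {i})" by (rule chart_ideal[OF X i(1)])
  have pow: "var i ^ d \<in> forms {..n} d" for d
  proof (induction d)
    case 0
    then show ?case by (auto simp: forms_def)
  next
    case (Suc d)
    then show ?case using forms_mult[OF var_in_forms Suc, of i] i(1) by simp
  qed
  have "dehom i (var i ^ d) = 1" for d
  proof (induction d)
    case 0
    then show ?case using dehom_const[of i 1] by (simp add: const_1)
  qed (simp add: dehom_mult)
  moreover have "dehom i (var i ^ d) \<in> X i"
    using eq pow[of d] saturated_ideal_forms[OF X pow] i(1) by (auto simp: graded_saturated_ideal_def)
  ultimately have "1 \<in> X i" by metis
  then show False
    using I.one_imp_carrier i(2) by simp
qed

lemma one_notin_saturated_ideal: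
  fixes X :: "nat \<Rightarrow> 'k::field_char_0 mpoly set"
  assumes "closed_subscheme n X" "nonempty_subscheme n X"
  shows "1 \<notin> saturated_ideal n X"
proof
  assume "1 \<in> saturated_ideal n X"
  then have "p \<in> saturated_ideal n X" if "p \<in> mpolys {..n}" for p
    using saturated_ideal_mult[OF assms(1) _ that, of 1] by simp
  then have "graded_saturated_ideal n X 0 = forms {..n} 0"
    using forms_subset_mpolys[of "{..n}" 0] by (auto simp: graded_saturated_ideal_def)
  then show False using graded_saturated_ideal_proper[OF assms] by blast
qed

section \<open>Hilbert functions of the coordinate ring and of its hyperplane sections\<close>

lemma coord_class_hom:
  assumes "closed_subscheme n X"
  shows "ring_hom_ring (poly_ring {..n}) (coord_ring n X) (coord_class n X)"
  unfolding coord_ring_def coord_class_def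
  by (rule ideal.rcos_ring_hom_ring[OF ideal_saturated_ideal[OF assms]])

lemma coord_class_eq_0:
  assumes "closed_subscheme n X" "p \<in> mpolys {..n}"
  shows "coord_class n X p = \<zero>\<^bsub>coord_ring n X\<^esub> \<longleftrightarrow> p \<in> saturated_ideal n X"
  using ker_rcos[OF ideal_saturated_ideal[OF assms(1)], of p] assms(2)
  by (simp add: coord_class_def coord_ring_def)

lemma hilbert_function_eq:
  fixes X :: "nat \<Rightarrow> 'k::field_char_0 mpoly set"
  assumes X: "closed_subscheme n X" "nonempty_subscheme n X"
  shows "hilbert_function n X d = graded_algebra.hf mscale (forms {..n}) (graded_saturated_ideal n X) d"
  unfolding hilbert_function_def
  by (rule ring_dim_image[OF coord_class_hom[OF X(1)] coord_class_eq_0[OF X(1)]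
        one_notin_saturated_ideal[OF X] graded_saturated_ideal(1)[OF X(1)]])
    (simp_all add: graded_saturated_ideal_def)

lemma linear_form_in_forms: "linear_form n a \<in> forms {..n} 1"
proof -
  have "(\<Sum>i\<in>A. const (a i) * var i) \<in> forms {..n} 1" if "A \<subseteq> {..n}" "finite A" for A
    using that(2,1)
  proof (induction A)
    case (insert i A)
    then show ?case
      using forms_mscale[OF var_in_forms, of i "{..n}" "a i"] by (auto simp: mscale_def intro!: forms_add)
  qed simp
  then show ?thesis by (simp add: linear_form_def)
qed

lemma section_ideal_mem:
  assumes X: "closed_subscheme n X" and h: "h \<in> mpolys {..n}" and p: "p \<in> mpolys {..n}"
  shows "coord_class n X p \<in> section_ideal n X h \<longleftrightarrow> (\<exists>g\<in>mpolys {..n}. p - g * h \<in> saturated_ideal n X)"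
proof -
  interpret \<phi>: ring_hom_ring "poly_ring {..n}" "coord_ring n X" "coord_class n X"
    by (rule coord_class_hom[OF X])
  have carr: "carrier (coord_ring n X) = coord_class n X ` mpolys {..n}"
    by (auto simp: coord_ring_def coord_class_def FactRing_def A_RCOSETS_def' a_r_coset_def)
  have eq: "coord_class n X p = coord_class n X q \<longleftrightarrow> p - q \<in> saturated_ideal n X"
    if "p \<in> mpolys {..n}" "q \<in> mpolys {..n}" for p q
  proof -
    have d: "p - q \<in> mpolys {..n}" using that by (rule mpolys_diff)
    have "coord_class n X p = coord_class n X (p - q) \<oplus>\<^bsub>coord_ring n X\<^esub> coord_class n X q"
      using \<phi>.hom_add[of "p - q" q] d that by simp
    moreover have "coord_class n X q = \<zero>\<^bsub>coord_ring n X\<^esub> \<oplus>\<^bsub>coord_ring n X\<^esub> coord_class n X q"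
      using \<phi>.hom_closed[of q] that by simp
    ultimately have "coord_class n X p = coord_class n X q \<longleftrightarrow> coord_class n X (p - q) = \<zero>\<^bsub>coord_ring n X\<^esub>"
      using \<phi>.hom_closed[of q] \<phi>.hom_closed[of "p - q"] that d
      by (metis \<phi>.S.add.right_cancel \<phi>.S.zero_closed poly_ring_simps(1))
    then show ?thesis using coord_class_eq_0[OF X d] by simp
  qed
  have "coord_class n X p \<in> section_ideal n X h \<longleftrightarrow>
      (\<exists>g\<in>mpolys {..n}. coord_class n X p = coord_class n X g \<otimes>\<^bsub>coord_ring n X\<^esub> coord_class n X h)"
    unfolding section_ideal_def cgenideal_def carr by blast
  also have "\<dots> \<longleftrightarrow> (\<exists>g\<in>mpolys {..n}. coord_class n X p = coord_class n X (g * h))"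
    using \<phi>.hom_mult h by (intro bex_cong) auto
  also have "\<dots> \<longleftrightarrow> (\<exists>g\<in>mpolys {..n}. p - g * h \<in> saturated_ideal n X)"
    using eq p h by (intro bex_cong refl) (auto simp: mpolys_mult)
  finally show ?thesis .
qed

lemma section_hilbert_function_eq:
  fixes X :: "nat \<Rightarrow> 'k::field_char_0 mpoly set"
  assumes X: "closed_subscheme n X" "nonempty_subscheme n X"
  shows "section_hilbert_function n X (linear_form n a) d =
    graded_algebra.hf mscale (forms {..n})
      (graded_algebra.add_gen (forms {..n}) (graded_saturated_ideal n X) (linear_form n a)) d"
proof -
  interpret A: graded_algebra mscale "forms {..n}" "var :: nat \<Rightarrow> 'k mpoly" n
    by (rule graded_algebra_forms)
  let ?h = "linear_form n a" and ?I = "graded_saturated_ideal n X"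
  have h1: "?h \<in> forms {..n} 1" by (rule linear_form_in_forms)
  then have h: "?h \<in> mpolys {..n}" using forms_subset_mpolys by blast
  have lin: "A.lin a = ?h" by (simp add: A.lin_def linear_form_def mscale_def)
  \<comment> \<open>This is I_X + (h), the kernel of the composite of the two quotient maps.\<close>
  define J where "J = {p \<in> mpolys {..n}. \<exists>g\<in>mpolys {..n}. p - g * ?h \<in> saturated_ideal n X}"
  have hcI: "hom_component e p \<in> ?I e" if "p \<in> saturated_ideal n X" for e p
    by (rule hom_component_saturated_ideal[OF X(1) that])
  have JI: "A.add_gen ?I ?h e = J \<inter> forms {..n} e" for e
  proof
    have "A.add_gen ?I ?h e \<subseteq> forms {..n} e"
      using A.graded_ideal_subset[OF A.graded_ideal_add_gen[OF graded_saturated_ideal(1)[OF X(1)]], of a e] lin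
      by simp
    moreover have "r \<in> J" if r: "r \<in> A.add_gen ?I ?h e" for r
    proof -
      from r obtain p q where pq: "r = p + ?h * q" "p \<in> ?I e" "q \<in> (case e of 0 \<Rightarrow> {0} | Suc e \<Rightarrow> forms {..n} e)"
        by (auto simp: A.add_gen_def)
      have "q \<in> mpolys {..n}"
        using pq(3) forms_subset_mpolys by (cases e) auto
      moreover have "r - q * ?h \<in> saturated_ideal n X"
        using pq(1,2) by (simp add: graded_saturated_ideal_def mult.commute)
      moreover have "r \<in> mpolys {..n}"
        using calculation(1) pq(1,2) h forms_subset_mpolys
        by (auto simp: graded_saturated_ideal_def intro!: mpolys_add mpolys_mult)
      ultimately show ?thesis by (auto simp: J_def)
    qed
    ultimately show "A.add_gen ?I ?h e \<subseteq> J \<inter> forms {..n} e" by blast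
    show "J \<inter> forms {..n} e \<subseteq> A.add_gen ?I ?h e"
    proof
      fix p assume "p \<in> J \<inter> forms {..n} e"
      then obtain g where g: "g \<in> mpolys {..n}" "p - g * ?h \<in> saturated_ideal n X" and p: "p \<in> forms {..n} e"
        by (auto simp: J_def)
      \<comment> \<open>Taking components of degree \<open>e\<close> makes the multiplier
        \<open>g\<close> homogeneous, as \<open>add_gen\<close> demands.\<close>
      have I: "p - hom_component e (g * ?h) \<in> ?I e"
        using hcI[OF g(2), of e] by (simp add: hom_component_diff hom_component_forms[OF p])
      show "p \<in> A.add_gen ?I ?h e"
      proof (cases e)
        case 0
        then have "p \<in> ?I e" using I hom_component_mult_form(2)[OF h1, of 0 g] by simp
        then show ?thesis using 0 by (auto simp: A.add_gen_def)
      next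
        case (Suc f)
        have "hom_component e (g * ?h) = ?h * hom_component f g"
          using hom_component_mult_form(1)[OF h1, of f g] Suc by (simp add: mult.commute)
        then have "p = (p - hom_component e (g * ?h)) + ?h * hom_component f g" by simp
        moreover have "hom_component f g \<in> (case e of 0 \<Rightarrow> {0} | Suc e \<Rightarrow> forms {..n} e)"
          using hom_component_in_forms[OF g(1), of f] Suc by simp
        ultimately show ?thesis
          using I unfolding A.add_gen_def by blast
      qed
    qed
  qed
  interpret \<phi>: ring_hom_ring "poly_ring {..n}" "coord_ring n X" "coord_class n X"
    by (rule coord_class_hom[OF X(1)])
  have cring: "cring (coord_ring n X)"
    unfolding coord_ring_def
    by (rule ideal.quotient_is_cring[OF ideal_saturated_ideal[OF X(1)] cring_poly_ring])
  have sec: "ideal (section_ideal n X ?h) (coord_ring n X)"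
    unfolding section_ideal_def
    using h \<phi>.hom_closed[of ?h] by (intro cring.cgenideal_ideal cring) simp
  interpret \<psi>: ring_hom_ring "coord_ring n X" "section_ring n X ?h" "(+>\<^bsub>coord_ring n X\<^esub>) (section_ideal n X ?h)"
    unfolding section_ring_def by (rule ideal.rcos_ring_hom_ring[OF sec])
  have hom: "ring_hom_ring (poly_ring {..n}) (section_ring n X ?h) (section_class n X ?h)"
  proof (rule ring_hom_ringI2)
    show "section_class n X ?h \<in> ring_hom (poly_ring {..n}) (section_ring n X ?h)"
      using ring_hom_trans[OF \<phi>.homh \<psi>.homh] by (simp add: section_class_def[abs_def] comp_def)
  qed (rule \<phi>.R.ring_axioms, rule \<psi>.S.ring_axioms)
  have ker: "section_class n X ?h p = \<zero>\<^bsub>section_ring n X ?h\<^esub> \<longleftrightarrow> p \<in> J" if "p \<in> mpolys {..n}" for p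
    unfolding section_class_def section_ring_def
    using ker_rcos[OF sec, of "coord_class n X p"] \<phi>.hom_closed[of p] that
      section_ideal_mem[OF X(1) h that]
    by (simp add: J_def)
  have "1 \<notin> J"
  proof
    assume "1 \<in> J"
    moreover have "1 \<in> forms {..n} 0" by (auto simp: forms_def)
    \<comment> \<open>In degree 0 the multiples of the linear form contribute nothing, so 1 would
      lie in I_X.\<close>
    ultimately have "1 \<in> A.add_gen ?I ?h 0" using JI[of 0] by blast
    then show False
      using one_notin_saturated_ideal[OF X] by (simp add: A.add_gen_def graded_saturated_ideal_def)
  qed
  then show ?thesis
    unfolding section_hilbert_function_def
    using ring_dim_image[OF hom ker _ A.graded_ideal_add_gen[OF graded_saturated_ideal(1)[OF X(1)], of a] ] JI
    by (simp add: lin)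
qed


section \<open>Binomial expansions\<close>

lemma tval_sum: "tval d a = (\<Sum>i<length a. (a ! i + (d - i)) choose (d - i))"
proof (induction a arbitrary: d)
  case (Cons x a)
  show ?case
    using Cons.IH[of "d - 1"] by (simp add: sum.lessThan_Suc_shift add.commute del: sum.lessThan_Suc)
qed simp

lemma tlow_sum: "tlow d a = (\<Sum>i<length a. (a ! i + (d - i) - 1) choose (d - i))"
proof (induction a arbitrary: d)
  case (Cons x a)
  show ?case
    using Cons.IH[of "d - 1"] by (simp add: sum.lessThan_Suc_shift add.commute del: sum.lessThan_Suc)
qed simp

text \<open>The upper indices k_d, k_{d-1}, ... of the binomial expansion, recovered from the
  difference set.\<close>

definition expansion_of_tuple :: "nat \<Rightarrow> nat list \<Rightarrow> nat list" where
  "expansion_of_tuple d a = map (\<lambda>i. a ! i + (d - i)) [0..<length a]"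

lemma is_binomial_expansion_of_tuple:
  assumes a: "tuple d a" "a \<noteq> []"
  shows "is_binomial_expansion d (tval d a) (expansion_of_tuple d a)"
proof -
  have len: "length a \<le> d" and sorted: "\<And>i j. i < j \<Longrightarrow> j < length a \<Longrightarrow> a ! j \<le> a ! i"
    using a(1) by (auto simp: tuple_def sorted_wrt_iff_nth_less)
  have "sorted_wrt (>) (expansion_of_tuple d a)"
    unfolding sorted_wrt_iff_nth_less
  proof (intro allI impI)
    fix i j assume ij: "i < j" "j < length (expansion_of_tuple d a)"
    then have "a ! j \<le> a ! i" "d - j < d - i" using sorted[of i j] len by (auto simp: expansion_of_tuple_def)
    then show "expansion_of_tuple d a ! j < expansion_of_tuple d a ! i"
      using ij by (simp add: expansion_of_tuple_def)
  qed
  then show ?thesis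
    using a(2) len by (simp add: is_binomial_expansion_def expansion_of_tuple_def tval_sum last_conv_nth)
qed

lemma tuple_of_binomial_expansion:
  assumes "is_binomial_expansion d c ks"
  obtains a where "tuple d a" "tval d a = c" "ks = expansion_of_tuple d a"
proof -
  define l where "l = length ks"
  define a where "a = map (\<lambda>i. ks ! i - (d - i)) [0..<l]"
  have l: "l > 0" "l \<le> d" and sorted: "\<And>i j. i < j \<Longrightarrow> j < l \<Longrightarrow> ks ! j < ks ! i"
    and last: "ks ! (l - 1) \<ge> d - (l - 1)" and c: "c = (\<Sum>i<l. (ks ! i) choose (d - i))"
    using assms by (auto simp: is_binomial_expansion_def l_def sorted_wrt_iff_nth_less last_conv_nth)
  \<comment> \<open>Strict decrease together with the bound on the last entry gives
    \<open>ks ! i >= d - i\<close>, so the truncated subtraction in \<open>a\<close> is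
    exact.\<close>
  have gap: "ks ! j + (j - i) \<le> ks ! i" if "i \<le> j" "j < l" for i j
    using that
  proof (induction rule: inc_induct)
    case (step i)
    then show ?case using sorted[of i "Suc i"] by simp
  qed simp
  have ge: "d - i \<le> ks ! i" if "i < l" for i
  proof -
    have "ks ! (l - 1) + (l - 1 - i) \<le> ks ! i" using that by (intro gap) auto
    then show ?thesis using last that l by linarith
  qed
  have "ks = expansion_of_tuple d a"
    using ge by (intro nth_equalityI) (auto simp: expansion_of_tuple_def a_def l_def)
  moreover have "tval d a = c"
    unfolding tval_sum c using ge by (intro sum.cong) (auto simp: a_def)
  moreover have "tuple d a"
    unfolding tuple_def sorted_wrt_iff_nth_less
  proof (intro conjI allI impI)
    fix i j assume ij: "i < j" "j < length a"
    then show "a ! i \<ge> a ! j"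
      using gap[of i j] l by (simp add: a_def)
  qed (use l in \<open>simp add: a_def\<close>)
  ultimately show thesis using that by blast
qed

lemma binomial_expansion_tval:
  assumes "tuple d a" "a \<noteq> []"
  shows "binomial_expansion d (tval d a) = expansion_of_tuple d a"
  unfolding binomial_expansion_def
proof (rule the_equality)
  fix ks assume "is_binomial_expansion d (tval d a) ks"
  then obtain b where "tuple d b" "tval d b = tval d a" "ks = expansion_of_tuple d b"
    by (rule tuple_of_binomial_expansion)
  then show "ks = expansion_of_tuple d a" using tval_inj assms(1) by blast
qed (rule is_binomial_expansion_of_tuple[OF assms])

lemma macaulay_difference_set_tval:
  assumes "tuple d a" "a \<noteq> []"
  shows "macaulay_difference_set d (tval d a) = a"
  unfolding macaulay_difference_set_def binomial_expansion_tval[OF assms]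
  by (intro nth_equalityI) (auto simp: expansion_of_tuple_def Let_def)

lemma macaulay_lower_tval:
  assumes "tuple d a" "a \<noteq> []"
  shows "macaulay_lower d (tval d a) = tlow d a"
  unfolding macaulay_lower_def binomial_expansion_tval[OF assms] tlow_sum
  by (simp add: expansion_of_tuple_def Let_def)


section \<open>Polynomial functions\<close>

lemma meval_add: "meval a (p + q) = meval a p + meval a q"
  unfolding meval_def
  by (rule setsum_keys_plus_distrib[where f = "\<lambda>m c. c * (\<Prod>i\<in>Poly_Mapping.keys m. a i ^ Poly_Mapping.lookup m i)"])
    (auto simp: distrib_right)

lemma meval_0 [simp]: "meval a 0 = 0"
  by (simp add: meval_def)

lemma meval_single:
  "meval a (Poly_Mapping.single m c) = c * (\<Prod>i\<in>Poly_Mapping.keys m. a i ^ Poly_Mapping.lookup m i)"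
  by (simp add: meval_def)

lemma meval_mult: "meval a (p * q) = meval a p * meval a q"
proof (induction rule: mpolys_induct[OF mpolys_UNIV[of p]])
  case (2 p p')
  then show ?case by (simp add: distrib_right meval_add)
next
  case (3 m c)
  show ?case
  proof (induction rule: mpolys_induct[OF mpolys_UNIV[of q]])
    case (2 q q')
    then show ?case by (simp add: distrib_left meval_add)
  next
    case (3 m' c')
    let ?K = "Poly_Mapping.keys m \<union> Poly_Mapping.keys m'"
    have "(\<Prod>i\<in>Poly_Mapping.keys m. a i ^ Poly_Mapping.lookup m i) = (\<Prod>i\<in>?K. a i ^ Poly_Mapping.lookup m i)"
      "(\<Prod>i\<in>Poly_Mapping.keys m'. a i ^ Poly_Mapping.lookup m' i) = (\<Prod>i\<in>?K. a i ^ Poly_Mapping.lookup m' i)"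
      by (auto intro!: prod.mono_neutral_left simp: in_keys_iff)
    then show ?case
      by (simp add: mult_single meval_single keys_add_nat lookup_add power_add prod.distrib)
  qed simp
qed simp

lemma meval_const [simp]: "meval a (const c) = c"
  by (simp add: const_def meval_single)

lemma meval_linear_form: "meval a (linear_form n k) = (\<Sum>j\<le>n. a j * k j)"
proof -
  have var: "meval a (var j) = a j" for j
    by (simp add: var_def meval_single)
  have "meval a (\<Sum>j\<in>A. const (k j) * var j) = (\<Sum>j\<in>A. a j * k j)" if "finite A" for A
    using that by induction (auto simp: meval_add meval_mult var)
  then show ?thesis by (simp add: linear_form_def)
qed

section \<open>The inequality between the two invariants\<close>

theorem proposition3p1:
  fixes n :: nat and X :: "nat \<Rightarrow> 'k::{alg_closed_field, field_char_0} mpoly set"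
  assumes "closed_subscheme n X" and "nonempty_subscheme n X"
  shows "M_number n X \<le> gotzmann_number n X"
proof -
  interpret A: graded_algebra mscale "forms {..n}" "var :: nat \<Rightarrow> 'k mpoly" n
    by (rule graded_algebra_forms)
  let ?I = "graded_saturated_ideal n X"
  have lin: "A.lin a = linear_form n a" for a
    by (simp add: A.lin_def linear_form_def mscale_def)
  note I = graded_saturated_ideal[OF assms(1)]
  have H: "hilbert_function n X d = A.hf ?I d" for d
    by (rule hilbert_function_eq[OF assms])
  have pos: "A.hf ?I d > 0" for d
    using A.hf_eq_0[OF I(1)] graded_saturated_ideal_proper[OF assms] by force
  obtain T where T: "T \<noteq> []" "\<And>d. d \<ge> length T \<Longrightarrow> tuple d T" "\<And>d. Suc d \<ge> length T \<Longrightarrow> A.hf ?I d = tval d T"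
    using A.gotzmann_regularity[OF I pos] by blast
  have "macaulay_difference_set d (hilbert_function n X d) = T" if "d \<ge> length T" for d
    using that macaulay_difference_set_tval[OF T(2)[OF that] T(1)] T(3)[of d] by (simp add: H)
  then have ev: "\<forall>\<^sub>F d in sequentially. macaulay_difference_set d (hilbert_function n X d) = T"
    by (auto simp: eventually_sequentially)
  have "gotzmann_difference_set n X = T"
    unfolding gotzmann_difference_set_def
  proof (rule the_equality)
    show "\<forall>\<^sub>F d in sequentially. macaulay_difference_set d (hilbert_function n X d) = T"
      by (rule ev)
    fix T' assume "\<forall>\<^sub>F d in sequentially. macaulay_difference_set d (hilbert_function n X d) = T'"
    from eventually_conj[OF this ev] show "T' = T"
      by (auto dest: eventually_happens)
  qed
  then have G: "gotzmann_number n X = length T" by (simp add: gotzmann_number_def)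
  \<comment> \<open>A point of the moment curve provides the coefficient vector at which the
    polynomial \<open>F\<close> below is nonzero, so the open set is nonempty.\<close>
  obtain s where s: "\<And>e. e \<le> length T - 1 \<Longrightarrow> A.colon ?I (A.curve s) e = ?I e"
    using A.curve_regular_exists[OF I] by blast
  let ?P = "{f. \<exists>F\<in>mpolys {..n}. \<forall>a. f a = meval a F}"
  have "\<exists>f\<in>?P. f (\<lambda>i. s ^ i) \<noteq> 0 \<and>
      (\<forall>a. f a \<noteq> 0 \<longrightarrow> A.colon ?I (A.lin a) (length T - 1) = ?I (length T - 1))"
  proof (rule A.regular_open[OF I(1)])
    show "A.colon ?I (A.lin (\<lambda>i. s ^ i)) (length T - 1) = ?I (length T - 1)"
      using s[of "length T - 1"] by (simp add: A.curve_def)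
    show "(\<lambda>_. 1) \<in> ?P"
      by (auto intro!: bexI[of _ "const 1"])
    show "(\<lambda>t. f t * g t) \<in> ?P" "(\<lambda>t. f t - g t) \<in> ?P" if fg: "f \<in> ?P" "g \<in> ?P" for f g
    proof -
      from fg obtain F G where FG: "F \<in> mpolys {..n}" "\<forall>a. f a = meval a F" "G \<in> mpolys {..n}" "\<forall>a. g a = meval a G"
        by blast
      then show "(\<lambda>t. f t * g t) \<in> ?P"
        by (auto intro!: bexI[of _ "F * G"] simp: meval_mult mpolys_mult)
      have "meval a (F + const (- 1) * G) = f a - g a" for a
        using FG by (simp add: meval_add meval_mult)
      then show "(\<lambda>t. f t - g t) \<in> ?P"
        using FG by (auto intro!: bexI[of _ "F + const (- 1) * G"] simp: mpolys_mult mpolys_add)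
    qed
    \<comment> \<open>Coefficients and variables exchange roles: \<open>linear_form n k\<close> is
      evaluated at the coefficient vector \<open>a\<close>.\<close>
    show "(\<lambda>a. \<Sum>j\<le>n. a j * k j) \<in> ?P" for k
      using linear_form_in_forms[of n k] forms_subset_mpolys[of "{..n}" 1]
      by (auto intro!: bexI[of _ "linear_form n k"] simp: meval_linear_form)
  qed
  then obtain F where F: "F \<in> mpolys {..n}" "meval (\<lambda>i. s ^ i) F \<noteq> 0"
    "\<And>a. meval a F \<noteq> 0 \<Longrightarrow> A.colon ?I (A.lin a) (length T - 1) = ?I (length T - 1)"
    by auto
  have "section_hilbert_function n X (linear_form n a) t = macaulay_lower t (hilbert_function n X t)"
    if a: "meval a F \<noteq> 0" and t: "t \<ge> length T" for a t
  proof -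
    have "section_hilbert_function n X (linear_form n a) t = tlow t T"
      using A.hf_section[OF I(1) T(2,1,3) F(3)[OF a] t] section_hilbert_function_eq[OF assms]
      by (simp add: lin)
    also have "\<dots> = macaulay_lower t (hilbert_function n X t)"
      using macaulay_lower_tval[OF T(2)[OF t] T(1)] T(3)[of t] t by (simp add: H)
    finally show ?thesis .
  qed
  then have "for_general_linear_form n (\<lambda>h. \<forall>t\<ge>length T.
      section_hilbert_function n X h t = macaulay_lower t (hilbert_function n X t))"
    unfolding for_general_linear_form_def using F(1,2) by blast
  \<comment> \<open>\<open>M_number\<close> ranges over degrees at least 1; here the nonemptiness of
    \<open>X\<close> enters, through that of \<open>T\<close>.\<close>
  moreover have "length T \<ge> 1" using T(1) by (cases T) auto
  ultimately show ?thesis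
    unfolding G M_number_def by (intro Least_le) simp
qed

end
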